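(* For each $\Sigma_0^b$-formula $\varphi$ in $L_{AID}$, the function $$C_\varphi(x)=\#\{i<|x|:\varphi(i)\}$$ is $\Sigma_0^b$-bitdefinable in $AID$. We always have $C_\varphi(x)\le|x|$.
   Context: Language. $L_{BA}$ has constants $0,1$, functions $x+y$, $\lfloor x/2\rfloor$, $|x|$ (binary length), $x\#y$ ($=2^{|x||y|}$), $x\cdot2^{|y|}$, $x\dot- y$ (truncated subtraction), $x[i,j)$ (the number $\sum_{i\le k<j}x_k2^{k-i}$, where $x=\sum_kx_k2^k$, $x_k\in\{0,1\}$), and relations $=,\le$. Abbreviations: $2x=x+x$, $xi=2x+i$ for $i<2$, $Bit(i,x)=x[i,i+1)$, $\|x\|=|\,|x|\,|$. A linear form $\ell\|\bar x\|$ is $\sum_ic_i\|x_i\|+d$ with numerals $c_i,d$. Quantifiers $Qx\le|t|$ are sharply bounded; $\Sigma_0^b$-formulae have only sharply bounded quantifiers. BASIC: $y\le x\to y\le x+1$; $x\ne x+1$; $0\le x$; $x\le y\wedge x\ne y\leftrightarrow x+1\le y$; $x\ne0\to2x\ne0$; $y\le x\vee x\le y$; $x\le y\wedge y\le x\to x=y$; $x\le y\wedge y\le z\to x\le z$; $|0|=0$; $x\ne0\to|2x|=|x|+1\wedge|2x+1|=|x|+1$; $|1|=1$; $x\le y\to|x|\le|y|$; $0\#y=1$; $x\ne0\to1\#(2x)=2(1\#x)\wedge1\#(2x+1)=2(1\#x)$; $x\#y=y\#x$; $|x|=|y|\to x\#z=y\#z$; $x\le x+y$; $x\le y\wedge x\ne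 y\to2x+1\le2y\wedge2x+1\ne2y$; $x+y=y+x$; $x+0=x$; $x+(y+1)=(x+y)+1$; $(x+y)+z=x+(y+z)$; $x+y\le x+z\leftrightarrow y\le z$; $x\ne0\to|x|=|\lfloor x/2\rfloor|+1$; $x=\lfloor y/2\rfloor\leftrightarrow(2x=y\vee2x+1=y)$ (Buss' axioms not mentioning multiplication); together with $j\le i\to x[i,j)=0$; $i<j\to x[i+1,j+1)=\lfloor x/2\rfloor[i,j)$; $(2x)[0,j+1)=2(x[0,j))$; $(2x+1)[0,j+1)=2(x[0,j))+1$; $x\cdot2^{|0|}=x$; $y\ne0\to x\cdot2^{|y|}=x\cdot2^{|\lfloor y/2\rfloor|}+x\cdot2^{|\lfloor y/2\rfloor|}$; $x\le y\to x\dot-y=0$; $x\ge y\to(x+1)\dot-y=(x\dot-y)+1$. For expanded languages, also equality axioms. The theory $\Sigma_0^b(L)-LIND$ consists of BASIC, Bit Extensionality $|x|=|y|\wedge\forall i<|x|(Bit(i,x)=Bit(i,y))\to x=y$, and $A(0)\wedge\forall y<|x|(A(y)\to A(y+1))\to A(|x|)$ for $\Sigma_0^b$-formulae $A$ of $L$. $AID$. $L_{AID}$ is $L_{BA}$ plus, for every linear form $\ell\|\bar x\|$, $\Sigma_0^b$-formulae $B(\bar x,p),\bar D(\bar x,p)=D_1,\dots,D_m$ of $L_{BA}$ and boolean formula $I(d_1,\dots,d_m,p_0,p_1)$, a predicate constant $A=A^{\ell,B,\bar D,I}$. $AID$ is $\Sigma_0^b(L_{AID})-LIND$ plus, for each such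 $A$: (A.0) $A(\bar x,p)\to0\ne|p|\le\ell\|\bar x\|$; (A.1) $0\ne|p|=\ell\|\bar x\|\to[A(\bar x,p)\leftrightarrow B(\bar x,p)]$; (A.2) $0\ne|p|<\ell\|\bar x\|\to[A(\bar x,p)\leftrightarrow I(\bar D(\bar x,p),A(\bar x,p0),A(\bar x,p1))]$. Bitdefinability. A function $f(\bar x)$ of polynomial growth rate is $\Sigma_0^b$-bitdefinable in $AID$ if there is a $\Sigma_0^b$-formula $A_f(i,\bar x)$ of $L_{AID}$ with $A_f(i,\bar x)\leftrightarrow Bit(i,f(\bar x))=1$ in the standard model. $\#S$ is the cardinality of $S$. *)

theory Defs
  imports Main "HOL-Library.Log_Nat" "HOL-Computational_Algebra.Polynomial"
begin

section \<open>The standard functions of \<open>L\<^sub>B\<^sub>A\<close>\<close>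

definition blen :: "nat \<Rightarrow> nat"  (\<open>\<bar>_\<bar>\<^sub>b\<close>) where
  "\<bar>x\<bar>\<^sub>b = floorlog 2 x"

definition smash :: "nat \<Rightarrow> nat \<Rightarrow> nat" where
  "smash x y = 2 ^ (\<bar>x\<bar>\<^sub>b * \<bar>y\<bar>\<^sub>b)"

definition part :: "nat \<Rightarrow> nat \<Rightarrow> nat \<Rightarrow> nat" where
  "part x i j = (\<Sum>k = i..<j. of_bool (bit x k) * 2 ^ (k - i))"

definition Bit :: "nat \<Rightarrow> nat \<Rightarrow> nat" where
  "Bit i x = part x i (i + 1)"


section \<open>Syntax\<close>

text \<open>Variables are de Bruijn indices: under a quantifier, \<open>Var 0\<close> is the bound variable and
  \<open>Var (Suc k)\<close> is the outer \<open>Var k\<close>. The bound of a bounded quantifier lies outside its scope.\<close>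

datatype tm =
    Var nat
  | Zero
  | One
  | Plus tm tm
  | Half tm
  | Len tm
  | Smash tm tm
  | Shift tm tm  \<comment> \<open>\<open>x\<cdot>2\<^bsup>|y|\<^esup>\<close>\<close>
  | Monus tm tm
  | Part tm tm tm  \<comment> \<open>\<open>x[i,j)\<close>\<close>

text \<open>First-order formulae over atomic formulae of type \<open>'a\<close>; \<open>L\<^sub>B\<^sub>A\<close> and \<open>L\<^sub>A\<^sub>I\<^sub>D\<close> differ
  only in their atomic formulae.\<close>

datatype 'a fm =
    Atom 'a
  | Neg "'a fm"
  | And "'a fm" "'a fm"
  | Or "'a fm" "'a fm"
  | Imp "'a fm" "'a fm"
  | All "'a fm"
  | Ex "'a fm"
  | BAll tm "'a fm"  \<comment> \<open>\<open>\<forall>x \<le> t\<close>\<close>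
  | BEx tm "'a fm"  \<comment> \<open>\<open>\<exists>x \<le> t\<close>\<close>

primrec Sigma0b :: "'a fm \<Rightarrow> bool" where
  "Sigma0b (Atom a) \<longleftrightarrow> True"
| "Sigma0b (Neg A) \<longleftrightarrow> Sigma0b A"
| "Sigma0b (And A B) \<longleftrightarrow> Sigma0b A \<and> Sigma0b B"
| "Sigma0b (Or A B) \<longleftrightarrow> Sigma0b A \<and> Sigma0b B"
| "Sigma0b (Imp A B) \<longleftrightarrow> Sigma0b A \<and> Sigma0b B"
| "Sigma0b (All A) \<longleftrightarrow> False"
| "Sigma0b (Ex A) \<longleftrightarrow> False"
| "Sigma0b (BAll t A) \<longleftrightarrow> (\<exists>s. t = Len s) \<and> Sigma0b A"
| "Sigma0b (BEx t A) \<longleftrightarrow> (\<exists>s. t = Len s) \<and> Sigma0b A"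

datatype ba_atom = Eq tm tm | Le tm tm

text \<open>Boolean formulae \<open>I(d\<^sub>1,\<dots>,d\<^sub>m,p\<^sub>0,p\<^sub>1)\<close>; \<open>D k\<close> stands for \<open>d\<^bsub>k+1\<^esub>\<close>.\<close>

datatype bool_fm =
    D nat
  | P0
  | P1
  | BNot bool_fm
  | BAnd bool_fm bool_fm
  | BOr bool_fm bool_fm

text \<open>\<open>Lin [c\<^sub>1,\<dots>,c\<^sub>n] d\<close> is the linear form \<open>c\<^sub>1\<parallel>x\<^sub>1\<parallel> + \<dots> + c\<^sub>n\<parallel>x\<^sub>n\<parallel> + d\<close>.\<close>

datatype lin_form = Lin (coeffs: "nat list") (offset: nat)

text \<open>The predicate constants of \<open>L\<^sub>A\<^sub>I\<^sub>D\<close>. In \<open>B(x\<^sub>1,\<dots>,x\<^sub>n,p)\<close> and the \<open>D\<^sub>j(x\<^sub>1,\<dots>,x\<^sub>n,p)\<close>,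
  \<open>x\<^bsub>k+1\<^esub>\<close> is \<open>Var k\<close> and \<open>p\<close> is \<open>Var n\<close>.\<close>

datatype ind_sym =
  IndSym (lform: lin_form) (base: "ba_atom fm") (side: "ba_atom fm list") (step: bool_fm)

datatype aid_atom =
    BA ba_atom
  | Ind ind_sym "tm list" tm  \<comment> \<open>\<open>A(x\<^sub>1,\<dots>,x\<^sub>n,p)\<close>\<close>

type_synonym ba_fm = "ba_atom fm"
type_synonym aid_fm = "aid_atom fm"

subsection \<open>Well-formedness: arities, and all free variables below \<open>n\<close>\<close>

primrec tm_below :: "nat \<Rightarrow> tm \<Rightarrow> bool" where
  "tm_below n (Var k) \<longleftrightarrow> k < n"
| "tm_below n Zero \<longleftrightarrow> True"
| "tm_below n One \<longleftrightarrow> True"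
| "tm_below n (Plus s t) \<longleftrightarrow> tm_below n s \<and> tm_below n t"
| "tm_below n (Half t) \<longleftrightarrow> tm_below n t"
| "tm_below n (Len t) \<longleftrightarrow> tm_below n t"
| "tm_below n (Smash s t) \<longleftrightarrow> tm_below n s \<and> tm_below n t"
| "tm_below n (Shift s t) \<longleftrightarrow> tm_below n s \<and> tm_below n t"
| "tm_below n (Monus s t) \<longleftrightarrow> tm_below n s \<and> tm_below n t"
| "tm_below n (Part s t u) \<longleftrightarrow> tm_below n s \<and> tm_below n t \<and> tm_below n u"

primrec fm_below :: "(nat \<Rightarrow> 'a \<Rightarrow> bool) \<Rightarrow> nat \<Rightarrow> 'a fm \<Rightarrow> bool" where
  "fm_below ok n (Atom a) \<longleftrightarrow> ok n a"
| "fm_below ok n (Neg A) \<longleftrightarrow> fm_below ok n A"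
| "fm_below ok n (And A B) \<longleftrightarrow> fm_below ok n A \<and> fm_below ok n B"
| "fm_below ok n (Or A B) \<longleftrightarrow> fm_below ok n A \<and> fm_below ok n B"
| "fm_below ok n (Imp A B) \<longleftrightarrow> fm_below ok n A \<and> fm_below ok n B"
| "fm_below ok n (All A) \<longleftrightarrow> fm_below ok (Suc n) A"
| "fm_below ok n (Ex A) \<longleftrightarrow> fm_below ok (Suc n) A"
| "fm_below ok n (BAll t A) \<longleftrightarrow> tm_below n t \<and> fm_below ok (Suc n) A"
| "fm_below ok n (BEx t A) \<longleftrightarrow> tm_below n t \<and> fm_below ok (Suc n) A"

primrec ba_atom_below :: "nat \<Rightarrow> ba_atom \<Rightarrow> bool" where
  "ba_atom_below n (Eq s t) \<longleftrightarrow> tm_below n s \<and> tm_below n t"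
| "ba_atom_below n (Le s t) \<longleftrightarrow> tm_below n s \<and> tm_below n t"

abbreviation ba_formula :: "nat \<Rightarrow> ba_fm \<Rightarrow> bool" where
  "ba_formula \<equiv> fm_below ba_atom_below"

primrec bool_below :: "nat \<Rightarrow> bool_fm \<Rightarrow> bool" where
  "bool_below m (D k) \<longleftrightarrow> k < m"
| "bool_below m P0 \<longleftrightarrow> True"
| "bool_below m P1 \<longleftrightarrow> True"
| "bool_below m (BNot I) \<longleftrightarrow> bool_below m I"
| "bool_below m (BAnd I J) \<longleftrightarrow> bool_below m I \<and> bool_below m J"
| "bool_below m (BOr I J) \<longleftrightarrow> bool_below m I \<and> bool_below m J"

definition ind_arity :: "ind_sym \<Rightarrow> nat" where
  "ind_arity S = length (coeffs (lform S))"

definition ind_sym_ok :: "ind_sym \<Rightarrow> bool" where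
  "ind_sym_ok S \<longleftrightarrow>
     (\<forall>F \<in> set (base S # side S). ba_formula (Suc (ind_arity S)) F \<and> Sigma0b F) \<and>
     bool_below (length (side S)) (step S)"

primrec aid_atom_below :: "nat \<Rightarrow> aid_atom \<Rightarrow> bool" where
  "aid_atom_below n (BA a) \<longleftrightarrow> ba_atom_below n a"
| "aid_atom_below n (Ind S ts p) \<longleftrightarrow>
     ind_sym_ok S \<and> length ts = ind_arity S \<and> (\<forall>t \<in> set ts. tm_below n t) \<and> tm_below n p"

abbreviation aid_formula :: "nat \<Rightarrow> aid_fm \<Rightarrow> bool" where
  "aid_formula \<equiv> fm_below aid_atom_below"


section \<open>The standard model\<close>

primrec tm_val :: "(nat \<Rightarrow> nat) \<Rightarrow> tm \<Rightarrow> nat" where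
  "tm_val e (Var k) = e k"
| "tm_val e Zero = 0"
| "tm_val e One = 1"
| "tm_val e (Plus s t) = tm_val e s + tm_val e t"
| "tm_val e (Half t) = tm_val e t div 2"
| "tm_val e (Len t) = \<bar>tm_val e t\<bar>\<^sub>b"
| "tm_val e (Smash s t) = smash (tm_val e s) (tm_val e t)"
| "tm_val e (Shift s t) = tm_val e s * 2 ^ \<bar>tm_val e t\<bar>\<^sub>b"
| "tm_val e (Monus s t) = tm_val e s - tm_val e t"
| "tm_val e (Part s t u) = part (tm_val e s) (tm_val e t) (tm_val e u)"

primrec fm_sat :: "((nat \<Rightarrow> nat) \<Rightarrow> 'a \<Rightarrow> bool) \<Rightarrow> (nat \<Rightarrow> nat) \<Rightarrow> 'a fm \<Rightarrow> bool" where
  "fm_sat M e (Atom a) \<longleftrightarrow> M e a"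
| "fm_sat M e (Neg A) \<longleftrightarrow> \<not> fm_sat M e A"
| "fm_sat M e (And A B) \<longleftrightarrow> fm_sat M e A \<and> fm_sat M e B"
| "fm_sat M e (Or A B) \<longleftrightarrow> fm_sat M e A \<or> fm_sat M e B"
| "fm_sat M e (Imp A B) \<longleftrightarrow> (fm_sat M e A \<longrightarrow> fm_sat M e B)"
| "fm_sat M e (All A) \<longleftrightarrow> (\<forall>v. fm_sat M (case_nat v e) A)"
| "fm_sat M e (Ex A) \<longleftrightarrow> (\<exists>v. fm_sat M (case_nat v e) A)"
| "fm_sat M e (BAll t A) \<longleftrightarrow> (\<forall>v \<le> tm_val e t. fm_sat M (case_nat v e) A)"
| "fm_sat M e (BEx t A) \<longleftrightarrow> (\<exists>v \<le> tm_val e t. fm_sat M (case_nat v e) A)"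

primrec ba_atom_sat :: "(nat \<Rightarrow> nat) \<Rightarrow> ba_atom \<Rightarrow> bool" where
  "ba_atom_sat e (Eq s t) \<longleftrightarrow> tm_val e s = tm_val e t"
| "ba_atom_sat e (Le s t) \<longleftrightarrow> tm_val e s \<le> tm_val e t"

abbreviation ba_sat :: "(nat \<Rightarrow> nat) \<Rightarrow> ba_fm \<Rightarrow> bool" where
  "ba_sat \<equiv> fm_sat ba_atom_sat"

primrec bool_val :: "bool list \<Rightarrow> bool \<Rightarrow> bool \<Rightarrow> bool_fm \<Rightarrow> bool" where
  "bool_val ds p0 p1 (D k) \<longleftrightarrow> ds ! k"
| "bool_val ds p0 p1 P0 \<longleftrightarrow> p0"
| "bool_val ds p0 p1 P1 \<longleftrightarrow> p1"
| "bool_val ds p0 p1 (BNot I) \<longleftrightarrow> \<not> bool_val ds p0 p1 I"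
| "bool_val ds p0 p1 (BAnd I J) \<longleftrightarrow> bool_val ds p0 p1 I \<and> bool_val ds p0 p1 J"
| "bool_val ds p0 p1 (BOr I J) \<longleftrightarrow> bool_val ds p0 p1 I \<or> bool_val ds p0 p1 J"

definition lin_val :: "lin_form \<Rightarrow> nat list \<Rightarrow> nat" where
  "lin_val l xs = (\<Sum>(c, x) \<leftarrow> zip (coeffs l) xs. c * \<bar>\<bar>x\<bar>\<^sub>b\<bar>\<^sub>b) + offset l"

lemma blen_eq_0_iff: "\<bar>x\<bar>\<^sub>b = 0 \<longleftrightarrow> x = 0"
  by (simp add: blen_def floorlog_def)

lemma blen_append_bit: "p \<noteq> 0 \<Longrightarrow> b < 2 \<Longrightarrow> \<bar>2 * p + b\<bar>\<^sub>b = Suc \<bar>p\<bar>\<^sub>b"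
  unfolding blen_def by (subst compute_floorlog) auto

text \<open>The extension of an inductively defined predicate, by recursion along its axioms from the
  leaves \<open>|p| = \<ell>\<parallel>x\<parallel>\<close> downwards; \<open>2p\<close> and \<open>2p+1\<close> are \<open>p0\<close> and \<open>p1\<close>.\<close>

function ind_holds :: "ind_sym \<Rightarrow> nat list \<Rightarrow> nat \<Rightarrow> bool" where
  "ind_holds S xs p \<longleftrightarrow>
     (if \<bar>p\<bar>\<^sub>b = 0 \<or> lin_val (lform S) xs < \<bar>p\<bar>\<^sub>b then False
      else if \<bar>p\<bar>\<^sub>b = lin_val (lform S) xs then ba_sat ((!) (xs @ [p])) (base S)
      else bool_val (map (ba_sat ((!) (xs @ [p]))) (side S))
             (ind_holds S xs (2 * p)) (ind_holds S xs (2 * p + 1)) (step S))"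
  by pat_completeness auto
termination
proof (relation "measure (\<lambda>(S, xs, p). lin_val (lform S) xs - \<bar>p\<bar>\<^sub>b)", goal_cases)
  case (2 S xs p)
  then show ?case using blen_append_bit[of p 0] by (auto simp: blen_eq_0_iff)
next
  case (3 S xs p)
  then show ?case using blen_append_bit[of p 1] by (auto simp: blen_eq_0_iff)
qed simp

declare ind_holds.simps [simp del]

primrec aid_atom_sat :: "(nat \<Rightarrow> nat) \<Rightarrow> aid_atom \<Rightarrow> bool" where
  "aid_atom_sat e (BA a) \<longleftrightarrow> ba_atom_sat e a"
| "aid_atom_sat e (Ind S ts p) \<longleftrightarrow> ind_holds S (map (tm_val e) ts) (tm_val e p)"

abbreviation aid_sat :: "(nat \<Rightarrow> nat) \<Rightarrow> aid_fm \<Rightarrow> bool" where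
  "aid_sat \<equiv> fm_sat aid_atom_sat"

text \<open>The AID axioms for a predicate constant, with the parameters fixed, hold for \<^const>\<open>ind_holds\<close>
  and determine it uniquely.\<close>

definition A_axioms :: "ind_sym \<Rightarrow> nat list \<Rightarrow> (nat \<Rightarrow> bool) \<Rightarrow> bool" where
  "A_axioms S xs A \<longleftrightarrow>
     (\<forall>p. A p \<longrightarrow> 0 \<noteq> \<bar>p\<bar>\<^sub>b \<and> \<bar>p\<bar>\<^sub>b \<le> lin_val (lform S) xs) \<and>
     (\<forall>p. 0 \<noteq> \<bar>p\<bar>\<^sub>b \<and> \<bar>p\<bar>\<^sub>b = lin_val (lform S) xs \<longrightarrow>
        (A p \<longleftrightarrow> ba_sat ((!) (xs @ [p])) (base S))) \<and>
     (\<forall>p. 0 \<noteq> \<bar>p\<bar>\<^sub>b \<and> \<bar>p\<bar>\<^sub>b < lin_val (lform S) xs \<longrightarrow>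
        (A p \<longleftrightarrow> bool_val (map (ba_sat ((!) (xs @ [p]))) (side S)) (A (2 * p)) (A (2 * p + 1)) (step S)))"

lemma A_axioms_ind_holds: "A_axioms S xs (ind_holds S xs)"
  unfolding A_axioms_def
proof (intro conjI allI impI, goal_cases)
  case (1 p) then show ?case by (subst (asm) ind_holds.simps) (auto split: if_splits)
next
  case (2 p) then show ?case by (subst (asm) ind_holds.simps) (auto split: if_splits)
next
  case (3 p) then show ?case by (subst ind_holds.simps) simp
next
  case (4 p) then show ?case by (subst ind_holds.simps) simp
qed

lemma A_axioms_unique:
  "A_axioms S xs A \<Longrightarrow> A p \<longleftrightarrow> ind_holds S xs p"
proof (induction S xs p rule: ind_holds.induct)
  case (1 S xs p)
  consider "\<bar>p\<bar>\<^sub>b = 0 \<or> lin_val (lform S) xs < \<bar>p\<bar>\<^sub>b"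
    | "0 \<noteq> \<bar>p\<bar>\<^sub>b" "\<bar>p\<bar>\<^sub>b = lin_val (lform S) xs"
    | "0 \<noteq> \<bar>p\<bar>\<^sub>b" "\<bar>p\<bar>\<^sub>b < lin_val (lform S) xs"
    by linarith
  then show ?case
  proof cases
    case 1
    have "\<not> A p" using 1 \<open>A_axioms S xs A\<close> unfolding A_axioms_def by (metis not_less)
    then show ?thesis using 1 by (subst ind_holds.simps) simp
  next
    case 2
    then show ?thesis using \<open>A_axioms S xs A\<close>
      unfolding A_axioms_def by (subst ind_holds.simps) simp
  next
    case 3
    then have "\<not> (\<bar>p\<bar>\<^sub>b = 0 \<or> lin_val (lform S) xs < \<bar>p\<bar>\<^sub>b)" "\<bar>p\<bar>\<^sub>b \<noteq> lin_val (lform S) xs"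
      by linarith+
    note IH = "1.IH"(1)[OF this "1.prems"] "1.IH"(2)[OF this "1.prems"]
    have "A p \<longleftrightarrow> bool_val (map (ba_sat ((!) (xs @ [p]))) (side S)) (A (2 * p)) (A (2 * p + 1)) (step S)"
      using 3 \<open>A_axioms S xs A\<close> unfolding A_axioms_def by blast
    then show ?thesis
      unfolding IH using 3 by (subst ind_holds.simps) simp
  qed
qed


section \<open>Bit-definability\<close>

definition poly_growth :: "nat \<Rightarrow> (nat list \<Rightarrow> nat) \<Rightarrow> bool" where
  "poly_growth n f \<longleftrightarrow>
     (\<exists>q :: nat poly. \<forall>xs. length xs = n \<longrightarrow> \<bar>f xs\<bar>\<^sub>b \<le> poly q (\<Sum>x \<leftarrow> xs. \<bar>x\<bar>\<^sub>b))"

text \<open>Functions of \<open>n\<close> arguments take them as a list of length \<open>n\<close>. In the defining formula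
  \<open>A\<^sub>f(i,x\<^sub>1,\<dots>,x\<^sub>n)\<close>, \<open>i\<close> is \<open>Var 0\<close> and \<open>x\<^sub>k\<close> is \<open>Var k\<close>.\<close>

definition bitdefinable :: "nat \<Rightarrow> (nat list \<Rightarrow> nat) \<Rightarrow> bool" where
  "bitdefinable n f \<longleftrightarrow> poly_growth n f \<and>
     (\<exists>A. aid_formula (Suc n) A \<and> Sigma0b A \<and>
        (\<forall>i xs. length xs = n \<longrightarrow> (aid_sat ((!) (i # xs)) A \<longleftrightarrow> Bit i (f xs) = 1)))"

text \<open>In \<open>\<phi>(i)\<close>, \<open>i\<close> is \<open>Var 0\<close> and the parameters \<open>ys\<close> are the variables from \<open>Var 1\<close> on.\<close>

definition count_fun :: "aid_fm \<Rightarrow> nat \<Rightarrow> nat list \<Rightarrow> nat" where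
  "count_fun \<phi> x ys = card {i. i < \<bar>x\<bar>\<^sub>b \<and> aid_sat ((!) (i # ys)) \<phi>}"

end

theory Submission
  imports Defs
begin

text \<open>Let logarithmic mean: bounded by a linear form in the \<open>\<parallel>x\<^sub>i\<parallel>\<close>. Call a relation tree-definable if its
truth value is the value at the root of a binary tree of logarithmic depth whose leaves and gates are
\<open>\<Sigma>\<^sub>0\<^sup>b(L\<^sub>B\<^sub>A)\<close> relations of the arguments and of the path \<open>p\<close> that leads to the node. These are exactly the
relations given by one atom \<open>A(x\<^sub>1,\<dots>,x\<^sub>n,1)\<close> of \<open>L\<^sub>A\<^sub>I\<^sub>D\<close> (\<open>tree_definable_imp_ind\<close> and
\<open>tree_definable_ind\<close>). The leaves may even be tree-definable themselves, because a second tree can be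
hung below each leaf of the first (\<open>tree_definable_graft\<close>). Conjunction is the case of a top tree with
two leaves; a sharply bounded existential quantifier is a top tree of disjunctions whose path spells
out the witness. Hence every \<open>\<Sigma>\<^sub>0\<^sup>b(L\<^sub>A\<^sub>I\<^sub>D)\<close> formula is tree-definable (\<open>aid_formula_tree_definable\<close>), and
what remains is to count with a tree whose leaves evaluate \<open>\<phi>\<close>.

Let \<open>h = \<parallel>x\<parallel>\<close> and add the bits \<open>\<phi>(0), \<dots>, \<phi>(|x| - 1)\<close>, followed by zeros up to \<open>2\<^sup>h\<close> summands, along a
balanced binary tree, with schoolbook addition at each of its nodes. Bit \<open>j\<close> of a sum is the exclusive
or of bit \<open>j\<close> of both summands and of the carry into position \<open>j\<close>; that carry is the majority of bit
\<open>j - 1\<close> of both summands and of the carry into position \<open>j - 1\<close>. Although each single addition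
propagates its carry through all positions, the whole circuit has logarithmic depth: at a node of
height \<open>k\<close>, give rank \<open>k + j\<close> to bit \<open>j\<close> and rank \<open>k + j - 1\<close> to the carry into position \<open>j\<close>; then both
formulae refer only to values of rank exactly one less. So the inputs relevant for bit \<open>j\<close> of the
total are reached by paths with \<open>h + j\<close> moves (\<open>tree_eval_adder\<close>).

A path through the unrolled circuit records its moves only: to the left summand, to the right
summand, or to a carry. To know which \<open>\<phi>(u)\<close> is asked for at a leaf, one has to delete the carry
moves from the path and to read the rest as the number \<open>u\<close>, so one has to count the moves of one kind
in final segments of a path of logarithmic length. Counting on a range of logarithmic length \<open>k\<close> is
possible by \<open>\<Sigma>\<^sub>0\<^sup>b(L\<^sub>B\<^sub>A)\<close> formulae (\<open>ba_definable_card\<close>): modulo \<open>2\<^sup>b - 1\<close>, a word whose bits stand only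
at multiples of \<open>b\<close> equals the number of its bits, and for \<open>b = |k| + 1\<close> the partial sums of the
results for the residue classes of positions modulo \<open>b\<close> fit, as fields of width \<open>b\<close>, into one word of
logarithmic length, which a sharply bounded quantifier can guess.\<close>

section \<open>Lengths and parts of numbers\<close>

lemma blen_le_iff: "\<bar>x\<bar>\<^sub>b \<le> k \<longleftrightarrow> x < 2 ^ k"
  by (simp add: blen_def floorlog_le_iff)

lemma less_two_power_blen: "x < 2 ^ \<bar>x\<bar>\<^sub>b"
  using blen_le_iff[of x "\<bar>x\<bar>\<^sub>b"] by simp

lemma less_blen_iff: "k < \<bar>x\<bar>\<^sub>b \<longleftrightarrow> 2 ^ k \<le> x"
  using blen_le_iff[of x k] by linarith

lemma blen_mono: "x \<le> y \<Longrightarrow> \<bar>x\<bar>\<^sub>b \<le> \<bar>y\<bar>\<^sub>b"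
  by (simp add: blen_def floorlog_mono)

lemma blen_eqI: "2 ^ k \<le> x \<Longrightarrow> x < 2 ^ Suc k \<Longrightarrow> \<bar>x\<bar>\<^sub>b = Suc k"
  using blen_le_iff[of x "Suc k"] less_blen_iff[of k x] by linarith

lemma blen_0 [simp]: "\<bar>0\<bar>\<^sub>b = 0"
  by (simp add: blen_eq_0_iff)

lemma blen_1 [simp]: "\<bar>Suc 0\<bar>\<^sub>b = Suc 0"
  by (rule blen_eqI) auto

lemma blen_le_self: "\<bar>x\<bar>\<^sub>b \<le> x"
  by (simp add: blen_le_iff)

lemma blen_div_power: "\<bar>x div 2 ^ k\<bar>\<^sub>b = \<bar>x\<bar>\<^sub>b - k"
proof (rule le_antisym)
  have "x < 2 ^ (\<bar>x\<bar>\<^sub>b - k) * 2 ^ k"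
    unfolding power_add[symmetric]
    using less_two_power_blen[of x] power_increasing[of "\<bar>x\<bar>\<^sub>b" "\<bar>x\<bar>\<^sub>b - k + k" "2::nat"] by linarith
  then show "\<bar>x div 2 ^ k\<bar>\<^sub>b \<le> \<bar>x\<bar>\<^sub>b - k"
    by (simp add: blen_le_iff div_less_iff_less_mult)
  have "x < 2 ^ \<bar>x div 2 ^ k\<bar>\<^sub>b * 2 ^ k"
    using less_two_power_blen[of "x div 2 ^ k"] by (simp add: div_less_iff_less_mult)
  then have "\<bar>x\<bar>\<^sub>b \<le> \<bar>x div 2 ^ k\<bar>\<^sub>b + k"
    by (simp add: blen_le_iff power_add)
  then show "\<bar>x\<bar>\<^sub>b - k \<le> \<bar>x div 2 ^ k\<bar>\<^sub>b" by simp
qed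

lemma blen_double: "x \<noteq> 0 \<Longrightarrow> \<bar>2 * x\<bar>\<^sub>b = Suc \<bar>x\<bar>\<^sub>b"
  "x \<noteq> 0 \<Longrightarrow> \<bar>Suc (2 * x)\<bar>\<^sub>b = Suc \<bar>x\<bar>\<^sub>b"
  using blen_append_bit[of x 0] blen_append_bit[of x 1] by simp_all

lemma blen_append:
  assumes "x \<noteq> 0" and "y < 2 ^ k"
  shows "\<bar>x * 2 ^ k + y\<bar>\<^sub>b = \<bar>x\<bar>\<^sub>b + k"
proof -
  obtain m where m: "\<bar>x\<bar>\<^sub>b = Suc m"
    using assms(1) blen_eq_0_iff[of x] by (cases "\<bar>x\<bar>\<^sub>b") simp_all
  have lo: "2 ^ m \<le> x"
    unfolding less_blen_iff[symmetric] m by simp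
  have hi: "x + 1 \<le> 2 ^ Suc m"
    using less_two_power_blen[of x] unfolding m by simp
  have "2 ^ (m + k) \<le> x * 2 ^ k + y"
    unfolding power_add by (rule trans_le_add1, rule mult_right_mono[OF lo]) simp
  moreover have "x * 2 ^ k + y < (x + 1) * 2 ^ k"
    using assms(2) by simp
  moreover have "(x + 1) * 2 ^ k \<le> 2 ^ Suc (m + k)"
    using mult_right_mono[OF hi, of "2 ^ k"] by (simp add: power_add)
  ultimately have "\<bar>x * 2 ^ k + y\<bar>\<^sub>b = Suc (m + k)"
    by (intro blen_eqI) linarith+
  then show ?thesis using m by simp
qed

lemma blen_power: "\<bar>2 ^ k\<bar>\<^sub>b = Suc k"
  by (rule blen_eqI) auto

lemma blen_smash: "\<bar>smash x y\<bar>\<^sub>b = \<bar>x\<bar>\<^sub>b * \<bar>y\<bar>\<^sub>b + 1"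
  by (simp add: smash_def blen_power)

lemma blen_add_le: "\<bar>x + y\<bar>\<^sub>b \<le> \<bar>x\<bar>\<^sub>b + \<bar>y\<bar>\<^sub>b"
proof (cases "x = 0 \<or> y = 0")
  case False
  then obtain a b where ab: "\<bar>x\<bar>\<^sub>b = Suc a" "\<bar>y\<bar>\<^sub>b = Suc b"
    using blen_eq_0_iff not0_implies_Suc by meson
  have "x < 2 ^ Suc a" "y < 2 ^ Suc b"
    using ab less_two_power_blen[of x] less_two_power_blen[of y] by simp_all
  moreover have "(2::nat) ^ Suc a \<le> 2 ^ (a + b + 1)" "(2::nat) ^ Suc b \<le> 2 ^ (a + b + 1)"
    by (rule power_increasing; simp)+
  moreover have "(2::nat) ^ (a + b + 2) = 2 ^ (a + b + 1) + 2 ^ (a + b + 1)" by simp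
  ultimately have "x + y < 2 ^ (a + b + 2)" by linarith
  then show ?thesis using ab by (simp add: blen_le_iff)
qed auto

lemma blen_mult_le: "\<bar>x * y\<bar>\<^sub>b \<le> \<bar>x\<bar>\<^sub>b + \<bar>y\<bar>\<^sub>b"
proof -
  have "x * y < 2 ^ \<bar>x\<bar>\<^sub>b * 2 ^ \<bar>y\<bar>\<^sub>b"
    by (rule mult_strict_mono) (use less_two_power_blen in auto)
  then show ?thesis by (simp add: blen_le_iff power_add)
qed

lemma part_Suc: "i \<le> j \<Longrightarrow> part x i (Suc j) = part x i j + of_bool (bit x j) * 2 ^ (j - i)"
  by (simp add: part_def)

lemma part_eq_take_drop_bit: "part x i j = take_bit (j - i) (drop_bit i x)"
proof (cases "i \<le> j")
  case True
  then show ?thesis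
  proof (induction j rule: dec_induct)
    case base then show ?case by (simp add: part_def)
  next
    case (step k)
    have "take_bit (Suc k - i) (drop_bit i x) = 2 ^ (k - i) * of_bool (bit x k) + take_bit (k - i) (drop_bit i x)"
      using step.hyps(1) by (simp only: Suc_diff_le take_bit_Suc_from_most bit_drop_bit_eq) (simp add: o_def)
    then show ?case using step.hyps(1) step.IH by (simp add: part_Suc)
  qed
qed (simp add: part_def)

lemma part_eq_div_mod: "part x i j = (x div 2 ^ i) mod 2 ^ (j - i)"
  by (simp add: part_eq_take_drop_bit take_bit_eq_mod drop_bit_eq_div)

lemma part_one_bit: "part x i (Suc i) = of_bool (bit x i)"
  by (simp add: part_def)

lemma Bit_eq: "Bit i x = of_bool (bit x i)"
  by (simp add: Bit_def part_one_bit)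

lemma part_upto_blen: "part x i \<bar>x\<bar>\<^sub>b = x div 2 ^ i"
proof -
  have "x div 2 ^ i < 2 ^ (\<bar>x\<bar>\<^sub>b - i)"
    using less_two_power_blen[of "x div 2 ^ i"] unfolding blen_div_power .
  then show ?thesis unfolding part_eq_div_mod by (rule mod_less)
qed

lemma bit_imp_less_blen:
  assumes "bit x i" shows "i < \<bar>x\<bar>\<^sub>b"
proof (rule ccontr)
  assume "\<not> i < \<bar>x\<bar>\<^sub>b"
  then have "x div 2 ^ i = 0" by (simp add: less_blen_iff not_le)
  with assms show False by (simp add: bit_iff_odd)
qed

section \<open>Relations definable by bounded formulae\<close>

text \<open>Definability is stated for functions and relations of an environment rather than of lists or of
syntax: free variables are the values \<open>e 0, \<dots>, e (n - 1)\<close>, and entering a quantifier replaces \<open>e\<close> by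
\<open>\<lambda>i. e (Suc i)\<close> with the bound variable at \<open>e 0\<close>. All closure properties then become introduction
rules that can be applied to the relation as it is written.\<close>

definition term_fun :: "nat \<Rightarrow> ((nat \<Rightarrow> nat) \<Rightarrow> nat) \<Rightarrow> bool" where
  "term_fun n f \<longleftrightarrow> (\<exists>t. tm_below n t \<and> (\<forall>e. tm_val e t = f e))"

definition ba_definable :: "nat \<Rightarrow> ((nat \<Rightarrow> nat) \<Rightarrow> bool) \<Rightarrow> bool" where
  "ba_definable n P \<longleftrightarrow> (\<exists>F. ba_formula n F \<and> Sigma0b F \<and> (\<forall>e. ba_sat e F \<longleftrightarrow> P e))"

lemma term_fun_var: "k < n \<Longrightarrow> term_fun n (\<lambda>e. e k)"
  unfolding term_fun_def by (rule exI[of _ "Var k"]) simp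

lemma term_fun_plus:
  assumes "term_fun n f" and "term_fun n g"
  shows "term_fun n (\<lambda>e. f e + g e)"
proof -
  obtain s t where "tm_below n s" "\<And>e. tm_val e s = f e"
      "tm_below n t" "\<And>e. tm_val e t = g e"
    using assms unfolding term_fun_def by auto
  then show ?thesis unfolding term_fun_def by (intro exI[of _ "Plus s t"]) simp
qed

lemma term_fun_const: "term_fun n (\<lambda>e. c)"
proof (induction c)
  case 0
  show ?case unfolding term_fun_def by (rule exI[of _ Zero]) simp
next
  case (Suc c)
  have "term_fun n (\<lambda>e. 1)" unfolding term_fun_def by (rule exI[of _ One]) simp
  from term_fun_plus[OF Suc this] show ?case by simp
qed

lemma term_fun_Suc: "term_fun n f \<Longrightarrow> term_fun n (\<lambda>e. Suc (f e))"
  using term_fun_plus[OF _ term_fun_const[of n 1]] by simp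

lemma term_fun_half:
  assumes "term_fun n f"
  shows "term_fun n (\<lambda>e. f e div 2)"
proof -
  obtain s where "tm_below n s" "\<And>e. tm_val e s = f e"
    using assms unfolding term_fun_def by auto
  then show ?thesis unfolding term_fun_def by (intro exI[of _ "Half s"]) simp
qed

lemma term_fun_blen:
  assumes "term_fun n f"
  shows "term_fun n (\<lambda>e. \<bar>f e\<bar>\<^sub>b)"
proof -
  obtain s where "tm_below n s" "\<And>e. tm_val e s = f e"
    using assms unfolding term_fun_def by auto
  then show ?thesis unfolding term_fun_def by (intro exI[of _ "Len s"]) simp
qed

lemma term_fun_smash:
  assumes "term_fun n f" and "term_fun n g"
  shows "term_fun n (\<lambda>e. smash (f e) (g e))"
proof -
  obtain s t where "tm_below n s" "\<And>e. tm_val e s = f e"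
      "tm_below n t" "\<And>e. tm_val e t = g e"
    using assms unfolding term_fun_def by auto
  then show ?thesis unfolding term_fun_def by (intro exI[of _ "Smash s t"]) simp
qed

lemma term_fun_shift:
  assumes "term_fun n f" and "term_fun n g"
  shows "term_fun n (\<lambda>e. f e * 2 ^ \<bar>g e\<bar>\<^sub>b)"
proof -
  obtain s t where "tm_below n s" "\<And>e. tm_val e s = f e"
      "tm_below n t" "\<And>e. tm_val e t = g e"
    using assms unfolding term_fun_def by auto
  then show ?thesis unfolding term_fun_def by (intro exI[of _ "Shift s t"]) simp
qed

lemma term_fun_power_blen: "term_fun n g \<Longrightarrow> term_fun n (\<lambda>e. 2 ^ \<bar>g e\<bar>\<^sub>b)"
  using term_fun_shift[OF term_fun_const[of n 1]] by simp

lemma term_fun_monus: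
  assumes "term_fun n f" and "term_fun n g"
  shows "term_fun n (\<lambda>e. f e - g e)"
proof -
  obtain s t where "tm_below n s" "\<And>e. tm_val e s = f e"
      "tm_below n t" "\<And>e. tm_val e t = g e"
    using assms unfolding term_fun_def by auto
  then show ?thesis unfolding term_fun_def by (intro exI[of _ "Monus s t"]) simp
qed

lemma term_fun_part:
  assumes "term_fun n f" and "term_fun n g" and "term_fun n h"
  shows "term_fun n (\<lambda>e. part (f e) (g e) (h e))"
proof -
  obtain s t u where "tm_below n s" "\<And>e. tm_val e s = f e"
      "tm_below n t" "\<And>e. tm_val e t = g e"
      "tm_below n u" "\<And>e. tm_val e u = h e"
    using assms unfolding term_fun_def by auto
  then show ?thesis unfolding term_fun_def by (intro exI[of _ "Part s t u"]) simp
qed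

lemma term_fun_mult_const: "term_fun n f \<Longrightarrow> term_fun n (\<lambda>e. c * f e)"
  by (induction c) (simp_all add: term_fun_const term_fun_plus)

lemma term_fun_min: "term_fun n f \<Longrightarrow> term_fun n g \<Longrightarrow> term_fun n (\<lambda>e. min (f e) (g e))"
proof -
  assume "term_fun n f" "term_fun n g"
  then have "term_fun n (\<lambda>e. f e - (f e - g e))" by (intro term_fun_monus)
  moreover have "f e - (f e - g e) = min (f e) (g e)" for e by simp
  ultimately show ?thesis by simp
qed

lemmas term_fun_intros = term_fun_var term_fun_const term_fun_Suc term_fun_plus term_fun_half
  term_fun_blen term_fun_smash term_fun_shift term_fun_power_blen term_fun_monus term_fun_part
  term_fun_mult_const term_fun_min

lemma term_fun_subst:
  assumes "term_fun m g" and "\<And>i. i < m \<Longrightarrow> term_fun n (\<lambda>e. f e i)"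
  shows "term_fun n (\<lambda>e. g (f e))"
proof -
  have "term_fun n (\<lambda>e. tm_val (f e) t)" if "tm_below m t" for t
    using that by (induction t) (auto intro!: term_fun_intros assms(2))
  note * = this
  obtain t where t: "tm_below m t" "\<And>e. tm_val e t = g e" using assms(1) unfolding term_fun_def by auto
  show ?thesis using *[OF t(1)] unfolding t(2) .
qed

lemma term_fun_weaken: "term_fun n f \<Longrightarrow> term_fun (Suc n) (\<lambda>e. f (\<lambda>i. e (Suc i)))"
  by (rule term_fun_subst[of n f _ "\<lambda>e i. e (Suc i)"]) (auto intro: term_fun_var)

lemma ba_definable_eq:
  assumes "term_fun n f" and "term_fun n g"
  shows "ba_definable n (\<lambda>e. f e = g e)"
proof -
  obtain s t where "tm_below n s" "\<And>e. tm_val e s = f e"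
      "tm_below n t" "\<And>e. tm_val e t = g e"
    using assms unfolding term_fun_def by auto
  then show ?thesis unfolding ba_definable_def by (intro exI[of _ "Atom (Eq s t)"]) simp
qed

lemma ba_definable_le:
  assumes "term_fun n f" and "term_fun n g"
  shows "ba_definable n (\<lambda>e. f e \<le> g e)"
proof -
  obtain s t where "tm_below n s" "\<And>e. tm_val e s = f e"
      "tm_below n t" "\<And>e. tm_val e t = g e"
    using assms unfolding term_fun_def by auto
  then show ?thesis unfolding ba_definable_def by (intro exI[of _ "Atom (Le s t)"]) simp
qed

lemma ba_definable_less: "term_fun n f \<Longrightarrow> term_fun n g \<Longrightarrow> ba_definable n (\<lambda>e. f e < g e)"
  using ba_definable_le[OF term_fun_Suc] by (simp add: Suc_le_eq)

lemma ba_definable_not: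
  assumes "ba_definable n P"
  shows "ba_definable n (\<lambda>e. \<not> P e)"
proof -
  obtain F where "ba_formula n F" "Sigma0b F" "\<And>e. ba_sat e F \<longleftrightarrow> P e"
    using assms unfolding ba_definable_def by auto
  then show ?thesis unfolding ba_definable_def by (intro exI[of _ "Neg F"]) simp
qed

lemma ba_definable_conj:
  assumes "ba_definable n P" and "ba_definable n Q"
  shows "ba_definable n (\<lambda>e. P e \<and> Q e)"
proof -
  obtain F G where "ba_formula n F" "Sigma0b F" "\<And>e. ba_sat e F \<longleftrightarrow> P e"
      "ba_formula n G" "Sigma0b G" "\<And>e. ba_sat e G \<longleftrightarrow> Q e"
    using assms unfolding ba_definable_def by auto
  then show ?thesis unfolding ba_definable_def by (intro exI[of _ "And F G"]) simp
qed

lemma ba_definable_disj: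
  assumes "ba_definable n P" and "ba_definable n Q"
  shows "ba_definable n (\<lambda>e. P e \<or> Q e)"
proof -
  obtain F G where "ba_formula n F" "Sigma0b F" "\<And>e. ba_sat e F \<longleftrightarrow> P e"
      "ba_formula n G" "Sigma0b G" "\<And>e. ba_sat e G \<longleftrightarrow> Q e"
    using assms unfolding ba_definable_def by auto
  then show ?thesis unfolding ba_definable_def by (intro exI[of _ "Or F G"]) simp
qed

lemma ba_definable_imp:
  assumes "ba_definable n P" and "ba_definable n Q"
  shows "ba_definable n (\<lambda>e. P e \<longrightarrow> Q e)"
proof -
  obtain F G where "ba_formula n F" "Sigma0b F" "\<And>e. ba_sat e F \<longleftrightarrow> P e"
      "ba_formula n G" "Sigma0b G" "\<And>e. ba_sat e G \<longleftrightarrow> Q e"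
    using assms unfolding ba_definable_def by auto
  then show ?thesis unfolding ba_definable_def by (intro exI[of _ "Imp F G"]) simp
qed

lemma ba_definable_const: "ba_definable n (\<lambda>e. b)"
  using ba_definable_eq[OF term_fun_const term_fun_const, of n 0 "if b then 0 else 1"]
  by (simp split: if_splits)

lemma ba_definable_iff:
  "ba_definable n P \<Longrightarrow> ba_definable n Q \<Longrightarrow> ba_definable n (\<lambda>e. P e \<longleftrightarrow> Q e)"
  using ba_definable_conj[OF ba_definable_imp[of n P Q] ba_definable_imp[of n Q P]]
  by (simp add: iff_conv_conj_imp)

lemma ba_definable_if:
  "ba_definable n C \<Longrightarrow> ba_definable n P \<Longrightarrow> ba_definable n Q \<Longrightarrow>
    ba_definable n (\<lambda>e. if C e then P e else Q e)"
  using ba_definable_conj[OF ba_definable_imp[of n C P] ba_definable_imp[OF ba_definable_not[of n C], of Q]]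
  by (simp add: if_bool_eq_conj)

lemma case_nat_0_Suc: "case_nat (e 0) (\<lambda>i. e (Suc i)) = e"
  by (auto split: nat.split)

lemma ba_definable_ball:
  assumes "ba_definable (Suc n) (\<lambda>e. Q (e 0) (\<lambda>i. e (Suc i)))" and "term_fun n t"
  shows "ba_definable n (\<lambda>e. \<forall>v \<le> \<bar>t e\<bar>\<^sub>b. Q v e)"
proof -
  obtain F s where "ba_formula (Suc n) F" "Sigma0b F" "\<And>e. ba_sat e F \<longleftrightarrow> Q (e 0) (\<lambda>i. e (Suc i))"
      "tm_below n s" "\<And>e. tm_val e s = t e"
    using assms unfolding ba_definable_def term_fun_def by auto
  then show ?thesis unfolding ba_definable_def by (intro exI[of _ "BAll (Len s) F"]) simp
qed

lemma ba_definable_bex: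
  assumes "ba_definable (Suc n) (\<lambda>e. Q (e 0) (\<lambda>i. e (Suc i)))" and "term_fun n t"
  shows "ba_definable n (\<lambda>e. \<exists>v \<le> \<bar>t e\<bar>\<^sub>b. Q v e)"
proof -
  obtain F s where "ba_formula (Suc n) F" "Sigma0b F" "\<And>e. ba_sat e F \<longleftrightarrow> Q (e 0) (\<lambda>i. e (Suc i))"
      "tm_below n s" "\<And>e. tm_val e s = t e"
    using assms unfolding ba_definable_def term_fun_def by auto
  then show ?thesis unfolding ba_definable_def by (intro exI[of _ "BEx (Len s) F"]) simp
qed

lemma ba_definable_bit:
  assumes "term_fun n f" and "term_fun n g"
  shows "ba_definable n (\<lambda>e. bit (f e) (g e))"
proof -
  have "ba_definable n (\<lambda>e. part (f e) (g e) (Suc (g e)) = 1)"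
    by (intro ba_definable_eq term_fun_intros assms)
  moreover have "part x i (Suc i) = 1 \<longleftrightarrow> bit x i" for x i by (simp add: part_one_bit)
  ultimately show ?thesis by simp
qed

lemmas ba_definable_intros = ba_definable_eq ba_definable_le ba_definable_less ba_definable_not
  ba_definable_conj ba_definable_disj ba_definable_imp ba_definable_iff ba_definable_if
  ba_definable_const ba_definable_ball ba_definable_bex ba_definable_bit

text \<open>Substitution of terms, proved by rebuilding the substituted formula from the closure properties; no
substitution on syntax with lifting of indices has to be defined.\<close>

lemma ba_definable_subst:
  assumes "ba_definable m P" and "\<And>i. i < m \<Longrightarrow> term_fun n (\<lambda>e. f e i)"
  shows "ba_definable n (\<lambda>e. P (f e))"
proof -
  have *: "ba_definable n (\<lambda>e. ba_sat (f e) F)"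
    if "ba_formula m F" "Sigma0b F" "\<And>i. i < m \<Longrightarrow> term_fun n (\<lambda>e. f e i)" for F and f :: "(nat \<Rightarrow> nat) \<Rightarrow> nat \<Rightarrow> nat"
    using that
  proof (induction F arbitrary: m n f)
    case (Atom a)
    have tm: "term_fun n (\<lambda>e. tm_val (f e) t)" if "tm_below m t" for t
      by (rule term_fun_subst[of m "\<lambda>e. tm_val e t"]) (use that Atom.prems(3) term_fun_def in auto)
    show ?case using Atom.prems(1) by (cases a) (simp_all add: ba_definable_eq ba_definable_le tm)
  next
    case (Neg F)
    then show ?case by (simp add: ba_definable_not)
  next
    case (And F G)
    show ?case using ba_definable_conj[OF And.IH(1)[of m n f] And.IH(2)[of m n f]] And.prems by simp
  next
    case (Or F G)
    show ?case using ba_definable_disj[OF Or.IH(1)[of m n f] Or.IH(2)[of m n f]] Or.prems by simp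
  next
    case (Imp F G)
    show ?case using ba_definable_imp[OF Imp.IH(1)[of m n f] Imp.IH(2)[of m n f]] Imp.prems by simp
  next
    case (BAll t F)
    then obtain s where s: "t = Len s" "tm_below m s" by auto
    have "term_fun n (\<lambda>e. tm_val (f e) s)"
      by (rule term_fun_subst[of m "\<lambda>e. tm_val e s"]) (use s(2) BAll.prems(3) term_fun_def in auto)
    moreover have "ba_definable (Suc n) (\<lambda>e. ba_sat (case_nat (e 0) (f (\<lambda>i. e (Suc i)))) F)"
    proof (rule BAll.IH[of "Suc m"])
      fix i assume "i < Suc m"
      then show "term_fun (Suc n) (\<lambda>e. case_nat (e 0) (f (\<lambda>i. e (Suc i))) i)"
        using term_fun_weaken[OF BAll.prems(3)] by (cases i) (auto intro: term_fun_var)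
    qed (use BAll.prems in auto)
    ultimately show ?case unfolding s(1) by (simp add: ba_definable_ball)
  next
    case (BEx t F)
    then obtain s where s: "t = Len s" "tm_below m s" by auto
    have "term_fun n (\<lambda>e. tm_val (f e) s)"
      by (rule term_fun_subst[of m "\<lambda>e. tm_val e s"]) (use s(2) BEx.prems(3) term_fun_def in auto)
    moreover have "ba_definable (Suc n) (\<lambda>e. ba_sat (case_nat (e 0) (f (\<lambda>i. e (Suc i)))) F)"
    proof (rule BEx.IH[of "Suc m"])
      fix i assume "i < Suc m"
      then show "term_fun (Suc n) (\<lambda>e. case_nat (e 0) (f (\<lambda>i. e (Suc i))) i)"
        using term_fun_weaken[OF BEx.prems(3)] by (cases i) (auto intro: term_fun_var)
    qed (use BEx.prems in auto)
    ultimately show ?case unfolding s(1) by (simp add: ba_definable_bex)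
  qed auto
  obtain F where F: "ba_formula m F" "Sigma0b F" "\<And>e. ba_sat e F \<longleftrightarrow> P e"
    using assms(1) unfolding ba_definable_def by auto
  show ?thesis using *[OF F(1,2) assms(2)] by (simp add: F(3))
qed

lemma tm_val_cong: "tm_below n t \<Longrightarrow> (\<And>i. i < n \<Longrightarrow> e i = e' i) \<Longrightarrow> tm_val e t = tm_val e' t"
  by (induction t) auto

lemma ba_sat_cong: "ba_formula n F \<Longrightarrow> (\<And>i. i < n \<Longrightarrow> e i = e' i) \<Longrightarrow> ba_sat e F = ba_sat e' F"
proof (induction F arbitrary: n e e')
  case (Atom a)
  then show ?case by (cases a) (auto simp: tm_val_cong[of n _ e e'])
next
  case (All F)
  have "ba_sat (case_nat v e) F = ba_sat (case_nat v e') F" for v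
    by (rule All.IH[of "Suc n"]) (use All.prems in \<open>auto split: nat.split\<close>)
  then show ?case by simp
next
  case (Ex F)
  have "ba_sat (case_nat v e) F = ba_sat (case_nat v e') F" for v
    by (rule Ex.IH[of "Suc n"]) (use Ex.prems in \<open>auto split: nat.split\<close>)
  then show ?case by simp
next
  case (BAll t F)
  have "ba_sat (case_nat v e) F = ba_sat (case_nat v e') F" for v
    by (rule BAll.IH[of "Suc n"]) (use BAll.prems in \<open>auto split: nat.split\<close>)
  then show ?case using BAll.prems tm_val_cong[of n t e e'] by simp
next
  case (BEx t F)
  have "ba_sat (case_nat v e) F = ba_sat (case_nat v e') F" for v
    by (rule BEx.IH[of "Suc n"]) (use BEx.prems in \<open>auto split: nat.split\<close>)
  then show ?case using BEx.prems tm_val_cong[of n t e e'] by simp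
next
  case (Neg F)
  show ?case using Neg.IH[of n e e'] Neg.prems by simp
next
  case (And F G)
  show ?case using And.IH(1)[of n e e'] And.IH(2)[of n e e'] And.prems by simp
next
  case (Or F G)
  show ?case using Or.IH(1)[of n e e'] Or.IH(2)[of n e e'] Or.prems by simp
next
  case (Imp F G)
  show ?case using Imp.IH(1)[of n e e'] Imp.IH(2)[of n e e'] Imp.prems by simp
qed

lemma ba_definable_cong:
  assumes "ba_definable n P" and "\<And>i. i < n \<Longrightarrow> e i = e' i"
  shows "P e = P e'"
proof -
  obtain F where F: "ba_formula n F" "\<And>e. ba_sat e F = P e"
    using assms(1) unfolding ba_definable_def by auto
  show ?thesis unfolding F(2)[symmetric] by (rule ba_sat_cong[OF F(1) assms(2)])
qed

section \<open>Logarithmically bounded terms\<close>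

definition lin_len :: "nat \<Rightarrow> ((nat \<Rightarrow> nat) \<Rightarrow> nat) \<Rightarrow> bool" where
  "lin_len n l \<longleftrightarrow> (\<exists>c d. \<forall>e. l e = (\<Sum>i<n. c i * \<bar>\<bar>e i\<bar>\<^sub>b\<bar>\<^sub>b) + d)"

text \<open>These are the numbers that can serve as depths of trees. They are also the lengths of the words
over which a \<open>\<Sigma>\<^sub>0\<^sup>b\<close> formula can quantify, by \<open>exp_logarithmic_bound\<close>.\<close>

definition logarithmic :: "nat \<Rightarrow> ((nat \<Rightarrow> nat) \<Rightarrow> nat) \<Rightarrow> bool" where
  "logarithmic n d \<longleftrightarrow> term_fun n d \<and> (\<exists>l. lin_len n l \<and> (\<forall>e. d e \<le> l e))"

lemma lin_lenI: "(\<And>e. l e = (\<Sum>i<n. c i * \<bar>\<bar>e i\<bar>\<^sub>b\<bar>\<^sub>b) + d) \<Longrightarrow> lin_len n l"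
  unfolding lin_len_def by blast

lemma lin_len_const: "lin_len n (\<lambda>e. c)"
  by (rule lin_lenI[where c = "\<lambda>_. 0" and d = c]) simp

lemma lin_len_var:
  assumes "k < n" shows "lin_len n (\<lambda>e. \<bar>\<bar>e k\<bar>\<^sub>b\<bar>\<^sub>b)"
proof -
  have "(\<Sum>i<n. of_bool (i = k) * \<bar>\<bar>e i\<bar>\<^sub>b\<bar>\<^sub>b) = (\<Sum>i<n. if i = k then \<bar>\<bar>e i\<bar>\<^sub>b\<bar>\<^sub>b else 0)" for e :: "nat \<Rightarrow> nat"
    by (rule sum.cong) auto
  moreover have "(\<Sum>i<n. if i = k then \<bar>\<bar>e i\<bar>\<^sub>b\<bar>\<^sub>b else 0) = \<bar>\<bar>e k\<bar>\<^sub>b\<bar>\<^sub>b" for e :: "nat \<Rightarrow> nat"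
    using assms by (subst sum.delta) auto
  ultimately show ?thesis by (intro lin_lenI[where c = "\<lambda>i. of_bool (i = k)" and d = 0]) simp
qed

lemma lin_len_plus:
  assumes "lin_len n f" and "lin_len n g"
  shows "lin_len n (\<lambda>e. f e + g e)"
proof -
  obtain c d c' d' where "\<And>e. f e = (\<Sum>i<n. c i * \<bar>\<bar>e i\<bar>\<^sub>b\<bar>\<^sub>b) + d" "\<And>e. g e = (\<Sum>i<n. c' i * \<bar>\<bar>e i\<bar>\<^sub>b\<bar>\<^sub>b) + d'"
    using assms unfolding lin_len_def by auto
  then show ?thesis
    by (intro lin_lenI[where c = "\<lambda>i. c i + c' i" and d = "d + d'"]) (simp add: algebra_simps sum.distrib)
qed

lemma lin_len_mult_const: "lin_len n f \<Longrightarrow> lin_len n (\<lambda>e. c * f e)"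
  by (induction c) (simp_all add: lin_len_const lin_len_plus)

lemma lin_len_sum: "(\<And>i. i \<in> I \<Longrightarrow> lin_len n (f i)) \<Longrightarrow> lin_len n (\<lambda>e. \<Sum>i\<in>I. f i e)"
  by (induction I rule: infinite_finite_induct) (simp_all add: lin_len_const lin_len_plus)

lemma term_fun_sum: "(\<And>i. i \<in> I \<Longrightarrow> term_fun n (f i)) \<Longrightarrow> term_fun n (\<lambda>e. \<Sum>i\<in>I. f i e)"
  by (induction I rule: infinite_finite_induct) (simp_all add: term_fun_const term_fun_plus)

lemma lin_len_term_fun: "lin_len n l \<Longrightarrow> term_fun n l"
proof -
  assume "lin_len n l"
  then obtain c d where "l = (\<lambda>e. (\<Sum>i<n. c i * \<bar>\<bar>e i\<bar>\<^sub>b\<bar>\<^sub>b) + d)" unfolding lin_len_def by blast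
  then show ?thesis by (auto intro!: term_fun_plus term_fun_const term_fun_sum term_fun_mult_const term_fun_blen term_fun_var)
qed

lemma lin_len_logarithmic: "lin_len n l \<Longrightarrow> logarithmic n l"
  unfolding logarithmic_def using lin_len_term_fun by blast

text \<open>Each function symbol changes the length of a value at most polynomially, so it changes the length of
the length at most linearly.\<close>

lemma log_log_term_bound:
  assumes "term_fun n f"
  shows "\<exists>l. lin_len n l \<and> (\<forall>e. \<bar>\<bar>f e\<bar>\<^sub>b\<bar>\<^sub>b \<le> l e)"
proof -
  define B where "B f \<longleftrightarrow> (\<exists>l. lin_len n l \<and> (\<forall>e. \<bar>\<bar>f e\<bar>\<^sub>b\<bar>\<^sub>b \<le> l e))" for f
  have add: "B h" if "B f" "B g" and le: "\<And>e. \<bar>\<bar>h e\<bar>\<^sub>b\<bar>\<^sub>b \<le> \<bar>\<bar>f e\<bar>\<^sub>b\<bar>\<^sub>b + \<bar>\<bar>g e\<bar>\<^sub>b\<bar>\<^sub>b + 1" for f g h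
  proof -
    obtain l where l: "lin_len n l" "\<And>e. \<bar>\<bar>f e\<bar>\<^sub>b\<bar>\<^sub>b \<le> l e" using \<open>B f\<close> unfolding B_def by blast
    obtain l' where l': "lin_len n l'" "\<And>e. \<bar>\<bar>g e\<bar>\<^sub>b\<bar>\<^sub>b \<le> l' e" using \<open>B g\<close> unfolding B_def by blast
    have "\<bar>\<bar>h e\<bar>\<^sub>b\<bar>\<^sub>b \<le> l e + l' e + 1" for e
      using le[of e] l(2)[of e] l'(2)[of e] by linarith
    then show ?thesis
      unfolding B_def by (intro exI[of _ "\<lambda>e. l e + l' e + 1"] conjI lin_len_plus lin_len_const l l') simp
  qed
  have le: "B g" if "B f" and "\<And>e. \<bar>g e\<bar>\<^sub>b \<le> \<bar>f e\<bar>\<^sub>b" for f g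
    by (rule add[OF \<open>B f\<close> \<open>B f\<close>]) (simp add: that(2) blen_mono le_SucI trans_le_add1)
  have const: "B (\<lambda>e. c)" for c
    unfolding B_def by (intro exI[of _ "\<lambda>e. \<bar>\<bar>c\<bar>\<^sub>b\<bar>\<^sub>b"]) (simp add: lin_len_const)
  have "B (\<lambda>e. tm_val e t)" if "tm_below n t" for t
    using that
  proof (induction t)
    case (Var k)
    then show ?case
      unfolding B_def by (intro exI[of _ "\<lambda>e. \<bar>\<bar>e k\<bar>\<^sub>b\<bar>\<^sub>b"]) (simp add: lin_len_var)
  next
    case (Plus s t)
    have "\<bar>\<bar>x + y\<bar>\<^sub>b\<bar>\<^sub>b \<le> \<bar>\<bar>x\<bar>\<^sub>b\<bar>\<^sub>b + \<bar>\<bar>y\<bar>\<^sub>b\<bar>\<^sub>b" for x y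
      using blen_mono[OF blen_add_le[of x y]] blen_add_le[of "\<bar>x\<bar>\<^sub>b" "\<bar>y\<bar>\<^sub>b"] by linarith
    with Plus show ?case by - (rule add[of "\<lambda>e. tm_val e s" "\<lambda>e. tm_val e t"], simp_all add: le_SucI)
  next
    case (Half t)
    then show ?case by - (rule le[of "\<lambda>e. tm_val e t"], simp_all add: blen_mono)
  next
    case (Len t)
    then show ?case by - (rule le[of "\<lambda>e. tm_val e t"], simp_all add: blen_le_self)
  next
    case (Smash s t)
    have "\<bar>\<bar>smash x y\<bar>\<^sub>b\<bar>\<^sub>b \<le> \<bar>\<bar>x\<bar>\<^sub>b\<bar>\<^sub>b + \<bar>\<bar>y\<bar>\<^sub>b\<bar>\<^sub>b + 1" for x y
      using blen_add_le[of "\<bar>x\<bar>\<^sub>b * \<bar>y\<bar>\<^sub>b" 1] blen_mult_le[of "\<bar>x\<bar>\<^sub>b" "\<bar>y\<bar>\<^sub>b"]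
      by (simp add: blen_smash)
    with Smash show ?case by - (rule add[of "\<lambda>e. tm_val e s" "\<lambda>e. tm_val e t"], simp_all)
  next
    case (Shift s t)
    have "\<bar>x * 2 ^ \<bar>y\<bar>\<^sub>b\<bar>\<^sub>b \<le> \<bar>x\<bar>\<^sub>b + \<bar>y\<bar>\<^sub>b" for x y
      using blen_append[of x 0 "\<bar>y\<bar>\<^sub>b"] by (cases "x = 0") simp_all
    then have "\<bar>\<bar>x * 2 ^ \<bar>y\<bar>\<^sub>b\<bar>\<^sub>b\<bar>\<^sub>b \<le> \<bar>\<bar>x\<bar>\<^sub>b\<bar>\<^sub>b + \<bar>\<bar>y\<bar>\<^sub>b\<bar>\<^sub>b" for x y
      by (meson blen_add_le blen_mono order_trans)
    with Shift show ?case by - (rule add[of "\<lambda>e. tm_val e s" "\<lambda>e. tm_val e t"], simp_all add: le_SucI)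
  next
    case (Monus s t)
    then show ?case by - (rule le[of "\<lambda>e. tm_val e s"], simp_all add: blen_mono)
  next
    case (Part s t u)
    have "part x i j \<le> x" for x i j
      using le_trans[OF mod_less_eq_dividend div_le_dividend] by (simp add: part_eq_div_mod)
    with Part show ?case by - (rule le[of "\<lambda>e. tm_val e s"], simp_all add: blen_mono)
  qed (simp_all add: const)
  note * = this
  obtain t where t: "tm_below n t" "\<And>e. tm_val e t = f e" using assms unfolding term_fun_def by auto
  show ?thesis using *[OF t(1)] unfolding t(2) B_def .
qed

lemma logarithmic_term_fun: "logarithmic n d \<Longrightarrow> term_fun n d"
  by (simp add: logarithmic_def)

lemma logarithmic_blen_blen: "term_fun n f \<Longrightarrow> logarithmic n (\<lambda>e. \<bar>\<bar>f e\<bar>\<^sub>b\<bar>\<^sub>b)"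
  unfolding logarithmic_def using log_log_term_bound[of n f] by (simp add: term_fun_blen)

lemma logarithmic_const: "logarithmic n (\<lambda>e. c)"
  by (simp add: lin_len_logarithmic lin_len_const)

lemma logarithmic_plus:
  assumes "logarithmic n f" and "logarithmic n g"
  shows "logarithmic n (\<lambda>e. f e + g e)"
proof -
  obtain l l' where "lin_len n l" "\<And>e. f e \<le> l e" "lin_len n l'" "\<And>e. g e \<le> l' e"
    using assms unfolding logarithmic_def by auto
  then have "\<exists>l. lin_len n l \<and> (\<forall>e. f e + g e \<le> l e)"
    by (intro exI[of _ "\<lambda>e. l e + l' e"]) (simp add: lin_len_plus add_mono)
  then show ?thesis using assms unfolding logarithmic_def by (simp add: term_fun_plus)
qed

lemma logarithmic_mult_const: "logarithmic n f \<Longrightarrow> logarithmic n (\<lambda>e. c * f e)"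
  by (induction c) (simp_all add: logarithmic_const logarithmic_plus)

lemma logarithmic_Suc: "logarithmic n f \<Longrightarrow> logarithmic n (\<lambda>e. Suc (f e))"
  using logarithmic_plus[OF _ logarithmic_const[of n 1]] by simp

lemma logarithmic_le:
  assumes "logarithmic n g" and "term_fun n f" and "\<And>e. f e \<le> g e"
  shows "logarithmic n f"
proof -
  obtain l where "lin_len n l" "\<And>e. g e \<le> l e" using assms(1) unfolding logarithmic_def by auto
  then have "lin_len n l \<and> (\<forall>e. f e \<le> l e)" using assms(3) order_trans by blast
  then show ?thesis using assms(2) unfolding logarithmic_def by auto
qed

lemma logarithmic_min: "term_fun n f \<Longrightarrow> logarithmic n g \<Longrightarrow> logarithmic n (\<lambda>e. min (f e) (g e))"
  by (rule logarithmic_le[of n g]) (auto intro: term_fun_min logarithmic_term_fun)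

lemma logarithmic_blen: "logarithmic n f \<Longrightarrow> logarithmic n (\<lambda>e. \<bar>f e\<bar>\<^sub>b)"
  by (rule logarithmic_le[of n f]) (auto intro: term_fun_blen logarithmic_term_fun blen_le_self)

text \<open>A linear form in the lengths of lengths of terms is bounded by one in those of their variables.\<close>

lemma logarithmic_subst:
  assumes "logarithmic m d" and "\<And>i. i < m \<Longrightarrow> term_fun n (\<lambda>e. f e i)"
  shows "logarithmic n (\<lambda>e. d (f e))"
proof -
  obtain l where l: "lin_len m l" "\<And>e. d e \<le> l e" using assms(1) unfolding logarithmic_def by blast
  then obtain c k where ck: "\<And>e. l e = (\<Sum>i<m. c i * \<bar>\<bar>e i\<bar>\<^sub>b\<bar>\<^sub>b) + k" unfolding lin_len_def by blast
  obtain L where L: "\<And>i. i < m \<Longrightarrow> lin_len n (L i)" "\<And>i e. i < m \<Longrightarrow> \<bar>\<bar>f e i\<bar>\<^sub>b\<bar>\<^sub>b \<le> L i e"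
    using log_log_term_bound[OF assms(2)] by metis
  have "d (f e) \<le> (\<Sum>i<m. c i * L i e) + k" for e
  proof -
    have "d (f e) \<le> (\<Sum>i<m. c i * \<bar>\<bar>f e i\<bar>\<^sub>b\<bar>\<^sub>b) + k" using l(2) ck by metis
    also have "\<dots> \<le> (\<Sum>i<m. c i * L i e) + k" using L(2) by (intro add_mono sum_mono mult_left_mono) auto
    finally show ?thesis .
  qed
  moreover have "lin_len n (\<lambda>e. (\<Sum>i<m. c i * L i e) + k)"
    using L(1) by (intro lin_len_plus lin_len_sum lin_len_mult_const lin_len_const) auto
  moreover have "term_fun n (\<lambda>e. d (f e))"
    by (rule term_fun_subst[OF logarithmic_term_fun[OF assms(1)] assms(2)])
  ultimately show ?thesis unfolding logarithmic_def by auto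
qed

text \<open>The length of \<open>x#y\<close> exceeds \<open>|x||y|\<close>, and \<open>2\<^bsup>\<parallel>x\<parallel>\<^esup> \<le> 2|x| + 1\<close>; so products of such powers are bounded by
lengths of terms.\<close>

lemma exp_logarithmic_bound:
  assumes "logarithmic n d"
  shows "\<exists>t. term_fun n t \<and> (\<forall>e. 2 ^ d e \<le> \<bar>t e\<bar>\<^sub>b)"
proof -
  define E where "E l \<longleftrightarrow> (\<exists>t. term_fun n t \<and> (\<forall>e. 2 ^ l e \<le> \<bar>t e\<bar>\<^sub>b))" for l :: "(nat \<Rightarrow> nat) \<Rightarrow> nat"
  have plus: "E (\<lambda>e. f e + g e)" if "E f" "E g" for f g
  proof -
    from that obtain s t where st: "term_fun n s" "term_fun n t" "\<And>e. 2 ^ f e \<le> \<bar>s e\<bar>\<^sub>b" "\<And>e. 2 ^ g e \<le> \<bar>t e\<bar>\<^sub>b"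
      unfolding E_def by auto
    have "2 ^ (f e + g e) \<le> \<bar>smash (s e) (t e)\<bar>\<^sub>b" for e
      using mult_mono[OF st(3)[of e] st(4)[of e]] by (simp add: blen_smash power_add)
    then show ?thesis using st(1,2) unfolding E_def by (intro exI[of _ "\<lambda>e. smash (s e) (t e)"]) (simp add: term_fun_smash)
  qed
  have one: "E (\<lambda>e. 1)"
    unfolding E_def by (rule exI[of _ "\<lambda>e. 2"]) (use blen_power[of 1] in \<open>auto intro: term_fun_const\<close>)
  have zero: "E (\<lambda>e. 0)"
    unfolding E_def by (rule exI[of _ "\<lambda>e. 2"]) (use blen_power[of 1] in \<open>auto intro: term_fun_const\<close>)
  have var: "E (\<lambda>e. \<bar>\<bar>e i\<bar>\<^sub>b\<bar>\<^sub>b)" if "i < n" for i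
  proof -
    have "2 ^ \<bar>\<bar>x\<bar>\<^sub>b\<bar>\<^sub>b \<le> \<bar>smash x 3\<bar>\<^sub>b" for x :: nat
    proof (cases "\<bar>\<bar>x\<bar>\<^sub>b\<bar>\<^sub>b")
      case (Suc k)
      then have "2 ^ k \<le> \<bar>x\<bar>\<^sub>b" using less_blen_iff[of k "\<bar>x\<bar>\<^sub>b"] by simp
      moreover have "\<bar>3\<bar>\<^sub>b = 2" using blen_eqI[of 1 3] by simp
      ultimately show ?thesis using Suc by (simp add: blen_smash)
    qed (simp add: blen_smash)
    then show ?thesis unfolding E_def using that
      by (intro exI[of _ "\<lambda>e. smash (e i) 3"]) (auto intro: term_fun_intros)
  qed
  have mult: "E (\<lambda>e. c * f e)" if "E f" for c f
    by (induction c) (use plus that zero in auto)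
  have const: "E (\<lambda>e. c)" for c
    using mult[OF one, of c] by simp
  obtain l where l: "lin_len n l" "\<And>e. d e \<le> l e" using assms(1) unfolding logarithmic_def by blast
  then obtain c k where ck: "l = (\<lambda>e. (\<Sum>i<n. c i * \<bar>\<bar>e i\<bar>\<^sub>b\<bar>\<^sub>b) + k)" unfolding lin_len_def by blast
  have "E (\<lambda>e. \<Sum>i<j. c i * \<bar>\<bar>e i\<bar>\<^sub>b\<bar>\<^sub>b)" if "j \<le> n" for j
    using that by (induction j) (simp_all add: zero plus mult var)
  then have "E l" unfolding ck by (intro plus const) simp
  then obtain t where t: "term_fun n t" "\<And>e. 2 ^ l e \<le> \<bar>t e\<bar>\<^sub>b" unfolding E_def by auto
  have "2 ^ d e \<le> \<bar>t e\<bar>\<^sub>b" for e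
    using t(2)[of e] power_increasing[OF l(2)[of e], of "2::nat"] by linarith
  then show ?thesis using t(1) by auto
qed

text \<open>A word of logarithmic length is a number below the length of some term, so that one sharply bounded
quantifier ranges over all of these words.\<close>

lemma ba_definable_bex_word:
  assumes "ba_definable (Suc n) (\<lambda>e. Q (e 0) (\<lambda>i. e (Suc i)))" and "logarithmic n d"
  shows "ba_definable n (\<lambda>e. \<exists>v < 2 ^ d e. Q v e)"
proof -
  obtain t where t: "term_fun n t" "\<And>e. 2 ^ d e \<le> \<bar>t e\<bar>\<^sub>b" using exp_logarithmic_bound[OF assms(2)] by blast
  have "ba_definable n (\<lambda>e. \<exists>v \<le> \<bar>t e\<bar>\<^sub>b. \<bar>v\<bar>\<^sub>b \<le> d e \<and> Q v e)"
    by (intro ba_definable_intros term_fun_intros assms t term_fun_weaken logarithmic_term_fun) auto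
  moreover have "(\<exists>v \<le> \<bar>t e\<bar>\<^sub>b. \<bar>v\<bar>\<^sub>b \<le> d e \<and> Q v e) \<longleftrightarrow> (\<exists>v < 2 ^ d e. Q v e)" for e
    using order_trans[OF less_imp_le t(2)[of e]] unfolding blen_le_iff by blast
  ultimately show ?thesis by simp
qed

lemma ba_definable_bex_less:
  assumes "ba_definable (Suc n) (\<lambda>e. Q (e 0) (\<lambda>i. e (Suc i)))" and "logarithmic n d"
  shows "ba_definable n (\<lambda>e. \<exists>v < d e. Q v e)"
proof -
  have "ba_definable n (\<lambda>e. \<exists>v < 2 ^ d e. v < d e \<and> Q v e)"
    by (intro ba_definable_bex_word ba_definable_intros term_fun_intros assms term_fun_weaken logarithmic_term_fun) auto
  moreover have "(\<exists>v < 2 ^ d e. v < d e \<and> Q v e) \<longleftrightarrow> (\<exists>v < d e. Q v e)" for e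
    using less_exp[of "d e"] order_less_trans by blast
  ultimately show ?thesis by simp
qed

lemma ba_definable_ball_less:
  assumes "ba_definable (Suc n) (\<lambda>e. Q (e 0) (\<lambda>i. e (Suc i)))" and "logarithmic n d"
  shows "ba_definable n (\<lambda>e. \<forall>v < d e. Q v e)"
  using ba_definable_not[OF ba_definable_bex_less[OF ba_definable_not[OF assms(1)] assms(2)]] by simp

section \<open>Evaluation of binary trees\<close>

text \<open>Nodes are named as in the axioms for the inductive predicates: the children of \<open>p\<close> are \<open>p0\<close> and \<open>p1\<close>,
so that the number \<open>p\<close> is the path to the node, written after a leading 1.\<close>

primrec tree_eval :: "(nat \<Rightarrow> bool) \<Rightarrow> (nat \<Rightarrow> bool \<Rightarrow> bool \<Rightarrow> bool) \<Rightarrow> nat \<Rightarrow> nat \<Rightarrow> bool" where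
  "tree_eval B F 0 p \<longleftrightarrow> B p"
| "tree_eval B F (Suc d) p \<longleftrightarrow> F p (tree_eval B F d (2 * p)) (tree_eval B F d (Suc (2 * p)))"

lemma tree_eval_add: "tree_eval B F (d + k) p = tree_eval (tree_eval B F k) F d p"
  by (induction d arbitrary: p) simp_all

text \<open>The nodes at distance \<open>k\<close> below \<open>p\<close> all have length \<open>|p| + k\<close>, so the leaf condition is only needed at
one length and the gates only at smaller ones.\<close>

lemma tree_eval_cong:
  assumes "p \<noteq> 0"
    and "\<And>q. \<bar>q\<bar>\<^sub>b = \<bar>p\<bar>\<^sub>b + d \<Longrightarrow> B q = B' q"
    and "\<And>q a b. \<bar>p\<bar>\<^sub>b \<le> \<bar>q\<bar>\<^sub>b \<Longrightarrow> \<bar>q\<bar>\<^sub>b < \<bar>p\<bar>\<^sub>b + d \<Longrightarrow> F q a b = F' q a b"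
  shows "tree_eval B F d p = tree_eval B' F' d p"
  using assms
proof (induction d arbitrary: p)
  case (Suc d)
  have "tree_eval B F d (2 * p) = tree_eval B' F' d (2 * p)"
    by (rule Suc.IH) (use Suc.prems in \<open>simp_all add: blen_double\<close>)
  moreover have "tree_eval B F d (Suc (2 * p)) = tree_eval B' F' d (Suc (2 * p))"
    by (rule Suc.IH) (use Suc.prems in \<open>simp_all add: blen_double\<close>)
  ultimately show ?case using Suc.prems(3)[of p] by simp
qed simp

lemma tree_eval_dual:
  "tree_eval (\<lambda>p. \<not> B p) (\<lambda>p a b. \<not> F p (\<not> a) (\<not> b)) d p \<longleftrightarrow> \<not> tree_eval B F d p"
  by (induction d arbitrary: p) simp_all

lemma tree_eval_leftmost: "tree_eval B (\<lambda>p a b. a) d p \<longleftrightarrow> B (p * 2 ^ d)"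
  by (induction d arbitrary: p) (simp_all add: mult.assoc mult.commute mult.left_commute)

lemma tree_eval_ex: "tree_eval B (\<lambda>p a b. a \<or> b) d p \<longleftrightarrow> (\<exists>w < 2 ^ d. B (p * 2 ^ d + w))"
proof (induction d arbitrary: p)
  case (Suc d)
  have "(\<exists>w < 2 ^ Suc d. B (p * 2 ^ Suc d + w)) \<longleftrightarrow>
    (\<exists>w < 2 ^ d. B (2 * p * 2 ^ d + w)) \<or> (\<exists>w < 2 ^ d. B (Suc (2 * p) * 2 ^ d + w))" (is "?l \<longleftrightarrow> ?r1 \<or> ?r2")
  proof
    assume ?l
    then obtain w where w: "w < 2 ^ Suc d" "B (p * 2 ^ Suc d + w)" by blast
    show "?r1 \<or> ?r2"
    proof (cases "w < 2 ^ d")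
      case True
      have "2 * p * 2 ^ d + w = p * 2 ^ Suc d + w" by simp
      with True w show ?thesis by metis
    next
      case False
      then have "Suc (2 * p) * 2 ^ d + (w - 2 ^ d) = p * 2 ^ Suc d + w" "w - 2 ^ d < 2 ^ d"
        using w(1) by simp_all
      with w show ?thesis by metis
    qed
  next
    assume "?r1 \<or> ?r2"
    then show ?l
    proof
      assume ?r1
      then obtain w where w: "w < 2 ^ d" "B (2 * p * 2 ^ d + w)" by blast
      have "2 * p * 2 ^ d + w = p * 2 ^ Suc d + w" "w < 2 ^ Suc d" using w by simp_all
      with w show ?l by metis
    next
      assume ?r2
      then obtain w where w: "w < 2 ^ d" "B (Suc (2 * p) * 2 ^ d + w)" by blast
      have "Suc (2 * p) * 2 ^ d + w = p * 2 ^ Suc d + (2 ^ d + w)" "2 ^ d + w < 2 ^ Suc d"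
        using w by simp_all
      with w show ?l by metis
    qed
  qed
  then show ?case by (simp only: tree_eval.simps Suc.IH)
qed simp

text \<open>The node reached from \<open>p\<close> by the path \<open>q\<close>, that is, \<open>p\<close> followed by \<open>q\<close> without its leading 1. It is
given by a term of \<open>L\<^sub>B\<^sub>A\<close>.\<close>

definition path_append :: "nat \<Rightarrow> nat \<Rightarrow> nat" where
  "path_append p q = p * 2 ^ \<bar>q div 2\<bar>\<^sub>b + part q 0 \<bar>q div 2\<bar>\<^sub>b"

lemma blen_half: "\<bar>q div 2\<bar>\<^sub>b = \<bar>q\<bar>\<^sub>b - 1"
  using blen_div_power[of q 1] by simp

lemma path_append_1: "path_append p (Suc 0) = p"
  by (simp add: path_append_def part_def)

lemma path_append_double:
  assumes "q \<noteq> 0"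
  shows "path_append p (2 * q) = 2 * path_append p q" "path_append p (Suc (2 * q)) = Suc (2 * path_append p q)"
proof -
  obtain m where m: "\<bar>q\<bar>\<^sub>b = Suc m" using assms blen_eq_0_iff[of q] by (cases "\<bar>q\<bar>\<^sub>b") simp_all
  have "(2 * q) mod (2 * 2 ^ m) = 2 * (q mod 2 ^ m)" "Suc (2 * q) mod (2 * 2 ^ m) = Suc (2 * (q mod 2 ^ m))"
    by (simp_all add: mod_mult_mult1) (simp add: mod_mult2_eq)
  then show "path_append p (2 * q) = 2 * path_append p q" "path_append p (Suc (2 * q)) = Suc (2 * path_append p q)"
    using m by (simp_all add: path_append_def part_eq_div_mod blen_half algebra_simps)
qed

lemma tree_eval_subtree:
  assumes "q \<noteq> 0"
  shows "tree_eval (\<lambda>q. B (path_append p q)) (\<lambda>q. F (path_append p q)) d q = tree_eval B F d (path_append p q)"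
  using assms by (induction d arbitrary: q) (simp_all add: path_append_double)

text \<open>If the length of the upper part is known, both parts of a composed path can be recovered by terms.\<close>

lemma path_append_parts:
  assumes "p \<noteq> 0" and "q \<noteq> 0" and "\<bar>p\<bar>\<^sub>b = k" and "r = path_append p q"
  shows "\<bar>r\<bar>\<^sub>b = k + \<bar>q\<bar>\<^sub>b - 1"
    and "part r (\<bar>r\<bar>\<^sub>b - k) \<bar>r\<bar>\<^sub>b = p"
    and "2 ^ \<bar>part r k \<bar>r\<bar>\<^sub>b\<bar>\<^sub>b + part r 0 (\<bar>r\<bar>\<^sub>b - k) = q"
proof -
  obtain m where m: "\<bar>q\<bar>\<^sub>b = Suc m" using assms(2) blen_eq_0_iff[of q] by (cases "\<bar>q\<bar>\<^sub>b") simp_all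
  have r: "r = p * 2 ^ m + q mod 2 ^ m"
    using m by (simp add: assms(4) path_append_def part_eq_div_mod blen_half)
  have len: "\<bar>r\<bar>\<^sub>b = k + m" unfolding r using blen_append[OF assms(1), of "q mod 2 ^ m" m] assms(3) by simp
  then show "\<bar>r\<bar>\<^sub>b = k + \<bar>q\<bar>\<^sub>b - 1" using m by simp
  have dm: "r div 2 ^ m = p" "r mod 2 ^ m = q mod 2 ^ m" unfolding r by simp_all
  show "part r (\<bar>r\<bar>\<^sub>b - k) \<bar>r\<bar>\<^sub>b = p" unfolding part_upto_blen using dm len by simp
  have rest: "\<bar>part r k \<bar>r\<bar>\<^sub>b\<bar>\<^sub>b = m"
    unfolding part_upto_blen blen_div_power using len by simp
  have q: "2 ^ m \<le> q" "q < 2 ^ m + 2 ^ m"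
    using m less_blen_iff[of m q] less_two_power_blen[of q] by simp_all
  then have "q mod 2 ^ m = q - 2 ^ m" by (simp add: le_mod_geq)
  then show "2 ^ \<bar>part r k \<bar>r\<bar>\<^sub>b\<bar>\<^sub>b + part r 0 (\<bar>r\<bar>\<^sub>b - k) = q"
    unfolding rest unfolding part_eq_div_mod using q dm len by simp
qed

section \<open>Tree-definable relations\<close>

text \<open>Gates may vary from node to node. A gate is a relation of the path for each pair of truth values of
the children; this covers the boolean formulae in side formulae that occur in the symbols of
\<open>L\<^sub>A\<^sub>I\<^sub>D\<close>.\<close>

definition tree_definable :: "nat \<Rightarrow> ((nat \<Rightarrow> nat) \<Rightarrow> bool) \<Rightarrow> bool" where
  "tree_definable n R \<longleftrightarrow> (\<exists>d B F. logarithmic n d \<and>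
     ba_definable (Suc n) (\<lambda>e. B (\<lambda>i. e (Suc i)) (e 0)) \<and>
     (\<forall>a b. ba_definable (Suc n) (\<lambda>e. F (\<lambda>i. e (Suc i)) (e 0) a b)) \<and>
     (\<forall>e. R e \<longleftrightarrow> tree_eval (B e) (F e) (d e) 1))"

lemma tree_definableI:
  assumes "logarithmic n d"
    and "ba_definable (Suc n) (\<lambda>e. B (\<lambda>i. e (Suc i)) (e 0))"
    and "\<And>a b. ba_definable (Suc n) (\<lambda>e. F (\<lambda>i. e (Suc i)) (e 0) a b)"
    and "\<And>e. R e \<longleftrightarrow> tree_eval (B e) (F e) (d e) 1"
  shows "tree_definable n R"
  unfolding tree_definable_def using assms by (intro exI[of _ d] exI[of _ B] exI[of _ F]) simp

lemma tree_definableE: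
  assumes "tree_definable n R"
  obtains d B F where "logarithmic n d"
    and "ba_definable (Suc n) (\<lambda>e. B (\<lambda>i. e (Suc i)) (e 0))"
    and "\<And>a b. ba_definable (Suc n) (\<lambda>e. F (\<lambda>i. e (Suc i)) (e 0) a b)"
    and "\<And>e. R e \<longleftrightarrow> tree_eval (B e) (F e) (d e) 1"
  using assms unfolding tree_definable_def by blast

lemma ba_definable_at:
  assumes "ba_definable (Suc n) (\<lambda>e. B (\<lambda>i. e (Suc i)) (e 0))"
    and "term_fun m t" and "\<And>i. i < n \<Longrightarrow> term_fun m (\<lambda>e. f e i)"
  shows "ba_definable m (\<lambda>e. B (f e) (t e))"
proof -
  have "term_fun m (\<lambda>e. case_nat (t e) (f e) i)" if "i < Suc n" for i
    using that assms(2,3) by (cases i) simp_all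
  from ba_definable_subst[where f = "\<lambda>e. case_nat (t e) (f e)", OF assms(1) this] show ?thesis by simp
qed

text \<open>A tree of depth \<open>d\<close> can be prolonged to any larger depth: the added gates copy their left child, and
a leaf forgets the added part of its path.\<close>

lemma tree_definable_pad:
  assumes "tree_definable n R"
  obtains d where "logarithmic n d"
    and "\<And>l. logarithmic n l \<Longrightarrow> (\<And>e. d e \<le> l e) \<Longrightarrow> \<exists>B F.
      ba_definable (Suc n) (\<lambda>e. B (\<lambda>i. e (Suc i)) (e 0)) \<and>
      (\<forall>a b. ba_definable (Suc n) (\<lambda>e. F (\<lambda>i. e (Suc i)) (e 0) a b)) \<and>
      (\<forall>e. R e \<longleftrightarrow> tree_eval (B e) (F e) (l e) 1)"
proof -
  obtain d B F where d: "logarithmic n d"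
    and B: "ba_definable (Suc n) (\<lambda>e. B (\<lambda>i. e (Suc i)) (e 0))"
    and F: "\<And>a b. ba_definable (Suc n) (\<lambda>e. F (\<lambda>i. e (Suc i)) (e 0) a b)"
    and R: "\<And>e. R e \<longleftrightarrow> tree_eval (B e) (F e) (d e) 1"
    using tree_definableE[OF assms] by blast
  have dS: "term_fun (Suc n) (\<lambda>e. d (\<lambda>i. e (Suc i)))"
    using term_fun_weaken[OF logarithmic_term_fun[OF d]] .
  show thesis
  proof (rule that[OF d])
    fix l assume l: "logarithmic n l" "\<And>e. d e \<le> l e"
    define B' where "B' e p \<longleftrightarrow> B e (part p (\<bar>p\<bar>\<^sub>b - Suc (d e)) \<bar>p\<bar>\<^sub>b)" for e p
    define F' where "F' e p a b \<longleftrightarrow> (if \<bar>p\<bar>\<^sub>b \<le> d e then F e p a b else a)" for e p a b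
    have "ba_definable (Suc n) (\<lambda>e. B' (\<lambda>i. e (Suc i)) (e 0))"
      unfolding B'_def by (rule ba_definable_at[OF B]) (intro term_fun_intros dS; simp)+
    moreover have "ba_definable (Suc n) (\<lambda>e. F' (\<lambda>i. e (Suc i)) (e 0) a b)" for a b
      unfolding F'_def by (intro ba_definable_if ba_definable_le ba_definable_const F term_fun_intros dS) simp
    moreover have "R e \<longleftrightarrow> tree_eval (B' e) (F' e) (l e) 1" for e
    proof -
      obtain k where k: "l e = d e + k" using l(2) le_Suc_ex by blast
      have B'_eq: "tree_eval (B' e) (F' e) k q \<longleftrightarrow> B e q" if q: "\<bar>q\<bar>\<^sub>b = Suc (d e)" for q
      proof -
        have "q \<noteq> 0" by (rule notI) (use q in simp)
        then have len: "\<bar>q * 2 ^ k\<bar>\<^sub>b = Suc (d e) + k" using blen_append[of q 0 k] q by simp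
        have "tree_eval (B' e) (F' e) k q = tree_eval (B' e) (\<lambda>p a b. a) k q"
          by (rule tree_eval_cong) (use \<open>q \<noteq> 0\<close> q in \<open>simp_all add: F'_def\<close>)
        also have "\<dots> = B e q"
          unfolding tree_eval_leftmost B'_def part_upto_blen using len by simp
        finally show ?thesis .
      qed
      have "tree_eval (B' e) (F' e) (l e) 1 = tree_eval (tree_eval (B' e) (F' e) k) (F' e) (d e) 1"
        unfolding k tree_eval_add ..
      also have "\<dots> = tree_eval (B e) (F e) (d e) 1"
        by (rule tree_eval_cong) (simp_all add: B'_eq F'_def)
      finally show ?thesis using R by simp
    qed
    ultimately show "\<exists>B F. ba_definable (Suc n) (\<lambda>e. B (\<lambda>i. e (Suc i)) (e 0)) \<and>
      (\<forall>a b. ba_definable (Suc n) (\<lambda>e. F (\<lambda>i. e (Suc i)) (e 0) a b)) \<and>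
      (\<forall>e. R e \<longleftrightarrow> tree_eval (B e) (F e) (l e) 1)"
      by (intro exI[of _ B'] exI[of _ F']) simp
  qed
qed

lemma tree_definable_ba: "ba_definable n P \<Longrightarrow> tree_definable n P"
  by (rule tree_definableI[of n "\<lambda>e. 0" "\<lambda>e p. P e" "\<lambda>e p a b. True"])
    (simp_all add: logarithmic_const ba_definable_const ba_definable_subst[of n P "Suc n" "\<lambda>e i. e (Suc i)"] term_fun_var)

lemma tree_definable_if:
  assumes "ba_definable n C" and "tree_definable n R" and "tree_definable n R'"
  shows "tree_definable n (\<lambda>e. if C e then R e else R' e)"
proof -
  obtain d where d: "logarithmic n d"
    and pad: "\<And>l. logarithmic n l \<Longrightarrow> (\<And>e. d e \<le> l e) \<Longrightarrow> \<exists>B F.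
      ba_definable (Suc n) (\<lambda>e. B (\<lambda>i. e (Suc i)) (e 0)) \<and>
      (\<forall>a b. ba_definable (Suc n) (\<lambda>e. F (\<lambda>i. e (Suc i)) (e 0) a b)) \<and>
      (\<forall>e. R e \<longleftrightarrow> tree_eval (B e) (F e) (l e) 1)"
    using tree_definable_pad[OF assms(2)] by blast
  obtain d' where d': "logarithmic n d'"
    and pad': "\<And>l. logarithmic n l \<Longrightarrow> (\<And>e. d' e \<le> l e) \<Longrightarrow> \<exists>B F.
      ba_definable (Suc n) (\<lambda>e. B (\<lambda>i. e (Suc i)) (e 0)) \<and>
      (\<forall>a b. ba_definable (Suc n) (\<lambda>e. F (\<lambda>i. e (Suc i)) (e 0) a b)) \<and>
      (\<forall>e. R' e \<longleftrightarrow> tree_eval (B e) (F e) (l e) 1)"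
    using tree_definable_pad[OF assms(3)] by blast
  define l where "l = (\<lambda>e. d e + d' e)"
  have l: "logarithmic n l" unfolding l_def by (rule logarithmic_plus[OF d d'])
  have "\<And>e. d e \<le> l e" "\<And>e. d' e \<le> l e" by (simp_all add: l_def)
  from pad[OF l this(1)] pad'[OF l this(2)]
  obtain B F B' F' where BF: "ba_definable (Suc n) (\<lambda>e. B (\<lambda>i. e (Suc i)) (e 0))"
      "\<And>a b. ba_definable (Suc n) (\<lambda>e. F (\<lambda>i. e (Suc i)) (e 0) a b)"
      "\<And>e. R e \<longleftrightarrow> tree_eval (B e) (F e) (l e) 1"
      "ba_definable (Suc n) (\<lambda>e. B' (\<lambda>i. e (Suc i)) (e 0))"
      "\<And>a b. ba_definable (Suc n) (\<lambda>e. F' (\<lambda>i. e (Suc i)) (e 0) a b)"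
      "\<And>e. R' e \<longleftrightarrow> tree_eval (B' e) (F' e) (l e) 1"
    by (elim exE conjE) (rule that; simp)
  have C: "ba_definable (Suc n) (\<lambda>e. C (\<lambda>i. e (Suc i)))"
    by (rule ba_definable_subst[OF assms(1)]) (simp add: term_fun_var)
  show ?thesis
    by (rule tree_definableI[OF l, of "\<lambda>e p. if C e then B e p else B' e p"
          "\<lambda>e p a b. if C e then F e p a b else F' e p a b"])
      (simp_all only: BF C ba_definable_if split: if_split, simp)
qed

lemma tree_definable_not:
  assumes "tree_definable n R"
  shows "tree_definable n (\<lambda>e. \<not> R e)"
proof -
  obtain d B F where d: "logarithmic n d"
    and B: "ba_definable (Suc n) (\<lambda>e. B (\<lambda>i. e (Suc i)) (e 0))"
    and F: "\<And>a b. ba_definable (Suc n) (\<lambda>e. F (\<lambda>i. e (Suc i)) (e 0) a b)"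
    and R: "\<And>e. R e \<longleftrightarrow> tree_eval (B e) (F e) (d e) 1"
    using tree_definableE[OF assms] by blast
  show ?thesis
    by (rule tree_definableI[OF d, of "\<lambda>e p. \<not> B e p" "\<lambda>e p a b. \<not> F e p (\<not> a) (\<not> b)"])
      (simp_all only: R tree_eval_dual ba_definable_not[OF B] ba_definable_not[OF F] not_not)
qed

lemma tree_definable_subst:
  assumes "tree_definable m R" and f: "\<And>i. i < m \<Longrightarrow> term_fun n (\<lambda>e. f e i)"
  shows "tree_definable n (\<lambda>e. R (f e))"
proof -
  obtain d B F where d: "logarithmic m d"
    and B: "ba_definable (Suc m) (\<lambda>e. B (\<lambda>i. e (Suc i)) (e 0))"
    and F: "\<And>a b. ba_definable (Suc m) (\<lambda>e. F (\<lambda>i. e (Suc i)) (e 0) a b)"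
    and R: "\<And>e. R e \<longleftrightarrow> tree_eval (B e) (F e) (d e) 1"
    using tree_definableE[OF assms(1)] by blast
  have f': "term_fun (Suc n) (\<lambda>e. f (\<lambda>i. e (Suc i)) i)" if "i < m" for i
    by (rule term_fun_weaken[OF f[OF that]])
  show ?thesis
  proof (rule tree_definableI[of n "\<lambda>e. d (f e)" "\<lambda>e. B (f e)" "\<lambda>e. F (f e)"])
    show "logarithmic n (\<lambda>e. d (f e))" by (rule logarithmic_subst[OF d f])
    show "ba_definable (Suc n) (\<lambda>e. B (f (\<lambda>i. e (Suc i))) (e 0))"
      by (rule ba_definable_at[OF B _ f']) (simp_all add: term_fun_var)
    show "ba_definable (Suc n) (\<lambda>e. F (f (\<lambda>i. e (Suc i))) (e 0) a b)" for a b
      by (rule ba_definable_at[of m "\<lambda>e p. F e p a b", OF F _ f']) (simp_all add: term_fun_var)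
  qed (rule R)
qed

text \<open>A tree whose leaves are tree-definable relations of the path is again a tree: a long path is cut
after \<open>d + 1\<close> bits into a leaf \<open>p\<close> of the upper tree and a path in the tree below \<open>p\<close>.\<close>

lemma tree_definable_graft:
  assumes d: "logarithmic n d"
    and F: "\<And>a b. ba_definable (Suc n) (\<lambda>e. F (\<lambda>i. e (Suc i)) (e 0) a b)"
    and "tree_definable (Suc n) (\<lambda>e. R (\<lambda>i. e (Suc i)) (e 0))"
  shows "tree_definable n (\<lambda>e. tree_eval (R e) (F e) (d e) 1)"
proof -
  obtain d' where d': "logarithmic (Suc n) d'"
    and pad: "\<And>l. logarithmic (Suc n) l \<Longrightarrow> (\<And>e. d' e \<le> l e) \<Longrightarrow> \<exists>B F.
      ba_definable (Suc (Suc n)) (\<lambda>e. B (\<lambda>i. e (Suc i)) (e 0)) \<and>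
      (\<forall>a b. ba_definable (Suc (Suc n)) (\<lambda>e. F (\<lambda>i. e (Suc i)) (e 0) a b)) \<and>
      (\<forall>e. R (\<lambda>i. e (Suc i)) (e 0) \<longleftrightarrow> tree_eval (B e) (F e) (l e) 1)"
    using tree_definable_pad[OF assms(3)] by blast
  obtain l where l: "lin_len (Suc n) l" "\<And>e. d' e \<le> l e" using d' unfolding logarithmic_def by blast
  obtain c k where ck: "\<And>e. l e = (\<Sum>i<Suc n. c i * \<bar>\<bar>e i\<bar>\<^sub>b\<bar>\<^sub>b) + k" using l(1) unfolding lin_len_def by blast
  obtain B' F' where B': "ba_definable (Suc (Suc n)) (\<lambda>e. B' (\<lambda>i. e (Suc i)) (e 0))"
    and F': "\<And>a b. ba_definable (Suc (Suc n)) (\<lambda>e. F' (\<lambda>i. e (Suc i)) (e 0) a b)"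
    and R: "\<And>e. R (\<lambda>i. e (Suc i)) (e 0) \<longleftrightarrow> tree_eval (B' e) (F' e) (l e) 1"
    using pad[OF lin_len_logarithmic[OF l(1)] l(2)] by blast
  (* All leaves p of the upper tree have the same length d + 1. A linear form depends on p only
     through ||p||, so after padding all lower trees have the same depth k'. *)
  define l' where "l' e = (\<Sum>i<n. c (Suc i) * \<bar>\<bar>e i\<bar>\<^sub>b\<bar>\<^sub>b) + k" for e :: "nat \<Rightarrow> nat"
  define k' where "k' e = c 0 * \<bar>Suc (d e)\<bar>\<^sub>b + l' e" for e
  have l': "lin_len n l'" by (rule lin_lenI) (rule l'_def)
  have k': "logarithmic n k'"
    unfolding k'_def by (intro logarithmic_plus logarithmic_mult_const logarithmic_blen logarithmic_Suc d lin_len_logarithmic l')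
  have l_eq: "l (case_nat p e) = k' e" if "\<bar>p\<bar>\<^sub>b = Suc (d e)" for p e
    unfolding ck k'_def l'_def sum.lessThan_Suc_shift using that by simp
  define top low where "top e r = part r (\<bar>r\<bar>\<^sub>b - Suc (d e)) \<bar>r\<bar>\<^sub>b"
    and "low e r = 2 ^ \<bar>part r (Suc (d e)) \<bar>r\<bar>\<^sub>b\<bar>\<^sub>b + part r 0 (\<bar>r\<bar>\<^sub>b - Suc (d e))" for e r
  define B where "B e r = B' (case_nat (top e r) e) (low e r)" for e r
  define G where "G e r a b = (if \<bar>r\<bar>\<^sub>b \<le> d e then F e r a b else F' (case_nat (top e r) e) (low e r) a b)" for e r a b
  have dS: "term_fun (Suc n) (\<lambda>e. d (\<lambda>i. e (Suc i)))"
    using term_fun_weaken[OF logarithmic_term_fun[OF d]] .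
  have top: "term_fun (Suc n) (\<lambda>e. top (\<lambda>i. e (Suc i)) (e 0))"
    unfolding top_def by (intro term_fun_intros dS) simp_all
  have low: "term_fun (Suc n) (\<lambda>e. low (\<lambda>i. e (Suc i)) (e 0))"
    unfolding low_def by (intro term_fun_intros dS) simp_all
  have env: "term_fun (Suc n) (\<lambda>e. case_nat (top (\<lambda>i. e (Suc i)) (e 0)) (\<lambda>i. e (Suc i)) i)" if "i < Suc n" for i
    using that top by (cases i) (simp_all add: term_fun_var)
  show ?thesis
  proof (rule tree_definableI[of n "\<lambda>e. d e + k' e" B G])
    show "logarithmic n (\<lambda>e. d e + k' e)" by (rule logarithmic_plus[OF d k'])
    show "ba_definable (Suc n) (\<lambda>e. B (\<lambda>i. e (Suc i)) (e 0))"
      unfolding B_def by (rule ba_definable_at[OF B' low env])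
    show "ba_definable (Suc n) (\<lambda>e. G (\<lambda>i. e (Suc i)) (e 0) a b)" for a b
      unfolding G_def
      by (intro ba_definable_if ba_definable_le F term_fun_intros dS
          ba_definable_at[of "Suc n" "\<lambda>e p. F' e p a b", OF F' low env]) simp_all
    fix e
    have bottom: "tree_eval (B e) (G e) (k' e) p = R e p" if p: "\<bar>p\<bar>\<^sub>b = Suc (d e)" for p
    proof -
      have p0: "p \<noteq> 0" by (rule notI) (use p in simp)
      have tl: "top e (path_append p q) = p" "low e (path_append p q) = q" "Suc (d e) \<le> \<bar>path_append p q\<bar>\<^sub>b"
        if "q \<noteq> 0" for q
        using path_append_parts[OF p0 that p refl] blen_eq_0_iff[of q] that by (simp_all add: top_def low_def)
      have "tree_eval (B e) (G e) (k' e) p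
        = tree_eval (\<lambda>q. B e (path_append p q)) (\<lambda>q. G e (path_append p q)) (k' e) 1"
        using tree_eval_subtree[of 1 "B e" p "G e"] by (simp add: path_append_1)
      also have "\<dots> = tree_eval (B' (case_nat p e)) (F' (case_nat p e)) (k' e) 1"
      proof (rule tree_eval_cong)
        fix q assume "\<bar>q\<bar>\<^sub>b = \<bar>1\<bar>\<^sub>b + k' e"
        then have "q \<noteq> 0" by (intro notI) simp
        then show "B e (path_append p q) = B' (case_nat p e) q" by (simp add: B_def tl)
      next
        fix q a b assume "\<bar>1\<bar>\<^sub>b \<le> \<bar>q\<bar>\<^sub>b"
        then have "q \<noteq> 0" by (intro notI) simp
        then have "\<not> \<bar>path_append p q\<bar>\<^sub>b \<le> d e" using tl(3)[of q] by linarith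
        with \<open>q \<noteq> 0\<close> show "G e (path_append p q) a b = F' (case_nat p e) q a b" by (simp add: G_def tl)
      qed simp
      also have "\<dots> = R e p" using R[of "case_nat p e"] l_eq[OF p] by simp
      finally show ?thesis .
    qed
    have "tree_eval (B e) (G e) (d e + k' e) 1 = tree_eval (tree_eval (B e) (G e) (k' e)) (G e) (d e) 1"
      by (rule tree_eval_add)
    also have "\<dots> = tree_eval (R e) (F e) (d e) 1"
      by (rule tree_eval_cong) (simp_all add: bottom G_def)
    finally show "tree_eval (R e) (F e) (d e) 1 = tree_eval (B e) (G e) (d e + k' e) 1" ..
  qed
qed

lemma tree_definable_conj:
  assumes R: "tree_definable n R" and R': "tree_definable n R'"
  shows "tree_definable n (\<lambda>e. R e \<and> R' e)"
proof -
  have weaken: "tree_definable (Suc n) (\<lambda>e. P (\<lambda>i. e (Suc i)))" if "tree_definable n P" for P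
    by (rule tree_definable_subst[OF that]) (simp add: term_fun_var)
  (* The tree of depth 1 has the leaves 2 and 3. *)
  have "tree_definable n (\<lambda>e. tree_eval (\<lambda>p. if p = 2 then R e else R' e) (\<lambda>p a b. a \<and> b) 1 1)"
    by (intro tree_definable_graft logarithmic_const ba_definable_const tree_definable_if weaken R R'
        ba_definable_eq term_fun_var term_fun_const) simp
  then show ?thesis by simp
qed

text \<open>The witness is read off the path of a tree of disjunctions that is deep enough for all candidates
\<open>v \<le> |t|\<close>.\<close>

lemma tree_definable_bex:
  assumes Q: "tree_definable (Suc n) (\<lambda>e. Q (e 0) (\<lambda>i. e (Suc i)))" and t: "term_fun n t"
  shows "tree_definable n (\<lambda>e. \<exists>v \<le> \<bar>t e\<bar>\<^sub>b. Q v e)"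
proof -
  obtain l where l: "lin_len n l" "\<And>e. \<bar>\<bar>t e\<bar>\<^sub>b\<bar>\<^sub>b \<le> l e" using log_log_term_bound[OF t] by blast
  (* The path without its leading 1. *)
  define val where "val p = part p 0 \<bar>p div 2\<bar>\<^sub>b" for p
  have val: "term_fun (Suc n) (\<lambda>e. val (e 0))"
    unfolding val_def by (intro term_fun_intros) simp_all
  have "term_fun (Suc n) (\<lambda>e. case_nat (val (e 0)) (\<lambda>i. e (Suc i)) i)" if "i < Suc n" for i
    using that val by (cases i) (simp_all add: term_fun_var)
  from tree_definable_subst[where f = "\<lambda>e. case_nat (val (e 0)) (\<lambda>i. e (Suc i))", OF Q this]
  have "tree_definable (Suc n) (\<lambda>e. Q (val (e 0)) (\<lambda>i. e (Suc i)))" by simp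
  from tree_definable_if[OF ba_definable_le[OF val term_fun_blen[OF term_fun_weaken[OF t]]] this
      tree_definable_ba[OF ba_definable_const]]
  have "tree_definable n (\<lambda>e. tree_eval (\<lambda>p. if val p \<le> \<bar>t e\<bar>\<^sub>b then Q (val p) e else False) (\<lambda>p a b. a \<or> b) (l e) 1)"
    by (rule tree_definable_graft[OF lin_len_logarithmic[OF l(1)] ba_definable_const])
  moreover have "tree_eval (\<lambda>p. if val p \<le> \<bar>t e\<bar>\<^sub>b then Q (val p) e else False) (\<lambda>p a b. a \<or> b) (l e) 1
    \<longleftrightarrow> (\<exists>v \<le> \<bar>t e\<bar>\<^sub>b. Q v e)" for e
  proof -
    have val_eq: "val (1 * 2 ^ l e + w) = w" if "w < 2 ^ l e" for w
      unfolding val_def blen_half part_eq_div_mod using that blen_append[of 1 w "l e"] by simp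
    have "v < 2 ^ l e" if "v \<le> \<bar>t e\<bar>\<^sub>b" for v
      using that l(2)[of e] unfolding blen_le_iff by linarith
    then show ?thesis unfolding tree_eval_ex using val_eq by (metis (no_types, lifting))
  qed
  ultimately show ?thesis by simp
qed

section \<open>Formulae with inductive predicates define trees\<close>

text \<open>The axioms for inner nodes and for leaves, read from \<open>p\<close> downwards to the leaves at length \<open>\<ell>\<parallel>x\<parallel>\<close>.\<close>

lemma ind_holds_tree_eval:
  assumes "p \<noteq> 0" and "\<bar>p\<bar>\<^sub>b + d = lin_val (lform S) xs"
  shows "ind_holds S xs p \<longleftrightarrow> tree_eval (\<lambda>p. ba_sat ((!) (xs @ [p])) (base S))
    (\<lambda>p a b. bool_val (map (ba_sat ((!) (xs @ [p]))) (side S)) a b (step S)) d p"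
  using assms
proof (induction d arbitrary: p)
  case 0
  have "\<bar>p\<bar>\<^sub>b \<noteq> 0" unfolding blen_eq_0_iff using 0 by simp
  moreover have "\<bar>p\<bar>\<^sub>b = lin_val (lform S) xs" using 0 by simp
  ultimately show ?case by (subst ind_holds.simps) simp
next
  case (Suc d)
  have "\<bar>2 * p\<bar>\<^sub>b + d = lin_val (lform S) xs" "\<bar>Suc (2 * p)\<bar>\<^sub>b + d = lin_val (lform S) xs"
    using Suc.prems by (simp_all add: blen_double)
  from Suc.IH[OF _ this(1)] Suc.IH[OF _ this(2)] Suc.prems show ?case
    by (subst ind_holds.simps) (simp add: blen_eq_0_iff)
qed

lemma lin_val_eq_sum:
  assumes "length xs = length (coeffs l)"
  shows "lin_val l xs = (\<Sum>i<length xs. coeffs l ! i * \<bar>\<bar>xs ! i\<bar>\<^sub>b\<bar>\<^sub>b) + offset l"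
  unfolding lin_val_def by (simp add: sum_list_sum_nth assms atLeast0LessThan)

text \<open>An atom \<open>A(t\<^sub>1,\<dots>,t\<^sub>m,p)\<close> refers to a node \<open>p\<close> of the tree for the arguments \<open>t\<^sub>i\<close>. It is the root of the
tree that arises by putting \<open>p\<close> in front of all paths. The depth is a linear form in the
\<open>\<parallel>t\<^sub>i\<parallel>\<close>, hence logarithmic.\<close>

lemma tree_definable_ind:
  assumes ok: "ind_sym_ok S" and len: "length ts = ind_arity S"
    and ts: "\<And>t. t \<in> set ts \<Longrightarrow> tm_below n t" and p: "tm_below n p"
  shows "tree_definable n (\<lambda>e. ind_holds S (map (tm_val e) ts) (tm_val e p))"
proof -
  define m where "m = ind_arity S"
  have tsf: "term_fun n (\<lambda>e. tm_val e (ts ! i))" if "i < m" for i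
    using ts[of "ts ! i"] that len unfolding term_fun_def m_def by auto
  have pf: "term_fun n (\<lambda>e. tm_val e p)" using p unfolding term_fun_def by auto
  define args where "args e = map (tm_val e) ts" for e
  define env where "env e q = (!) (args e @ [path_append (tm_val e p) q])" for e q
  have env_term: "term_fun (Suc n) (\<lambda>e. env (\<lambda>i. e (Suc i)) (e 0) i)" if "i < Suc m" for i
  proof (cases "i < m")
    case True
    then have "env e q i = tm_val e (ts ! i)" for e q
      using len by (simp add: env_def args_def nth_append m_def)
    then show ?thesis using term_fun_weaken[OF tsf[OF True]] by simp
  next
    case False
    then have i: "i = length ts" using that len by (simp add: m_def)
    have "term_fun (Suc n) (\<lambda>e. path_append (tm_val (\<lambda>i. e (Suc i)) p) (e 0))"
      unfolding path_append_def by (intro term_fun_intros term_fun_weaken[OF pf]) simp_all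
    moreover have "env e q i = path_append (tm_val e p) q" for e q
      by (simp add: env_def args_def nth_append i)
    ultimately show ?thesis by simp
  qed
  have sat: "ba_definable (Suc n) (\<lambda>e. ba_sat (env (\<lambda>i. e (Suc i)) (e 0)) F)"
    if "F = base S \<or> F \<in> set (side S)" for F
  proof (rule ba_definable_subst[of "Suc m" "\<lambda>e. ba_sat e F"])
    show "ba_definable (Suc m) (\<lambda>e. ba_sat e F)"
      using ok that unfolding ind_sym_ok_def ba_definable_def m_def by (intro exI[of _ F]) auto
  qed (rule env_term)
  have step: "ba_definable (Suc n) (\<lambda>e. bool_val (map (ba_sat (env (\<lambda>i. e (Suc i)) (e 0))) (side S)) a b I)"
    if "bool_below (length (side S)) I" for I a b
    using that
  proof (induction I)
    case (D k)
    then show ?case using sat[of "side S ! k"] by simp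
  qed (simp_all add: ba_definable_const ba_definable_not ba_definable_conj ba_definable_disj)
  define L where "L e = lin_val (lform S) (args e)" for e
  have L: "logarithmic n L"
  proof -
    define l where "l e = (\<Sum>i<m. coeffs (lform S) ! i * \<bar>\<bar>e i\<bar>\<^sub>b\<bar>\<^sub>b) + offset (lform S)" for e :: "nat \<Rightarrow> nat"
    have "logarithmic m l" by (intro lin_len_logarithmic lin_lenI) (rule l_def)
    from logarithmic_subst[where f = "\<lambda>e i. tm_val e (ts ! i)", OF this tsf]
    have "logarithmic n (\<lambda>e. l (\<lambda>i. tm_val e (ts ! i)))" by simp
    moreover have "l (\<lambda>i. tm_val e (ts ! i)) = L e" for e
    proof -
      have "length (args e) = length (coeffs (lform S))" using len by (simp add: args_def ind_arity_def)
      from lin_val_eq_sum[OF this] show ?thesis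
        using len by (simp add: L_def l_def args_def m_def ind_arity_def)
    qed
    ultimately show ?thesis by simp
  qed
  (* By its first axiom, the predicate is false at paths that are empty or too long. *)
  define C where "C e \<longleftrightarrow> tm_val e p \<noteq> 0 \<and> \<bar>tm_val e p\<bar>\<^sub>b \<le> L e" for e
  define d where "d e = L e - \<bar>tm_val e p\<bar>\<^sub>b" for e
  define B where "B e q = ba_sat (env e q) (base S)" for e q
  define F where "F e q a b = bool_val (map (ba_sat (env e q)) (side S)) a b (step S)" for e q a b
  have "logarithmic n (\<lambda>e. d e)"
    unfolding d_def
    by (rule logarithmic_le[OF L]) (intro term_fun_monus term_fun_blen pf logarithmic_term_fun[OF L], simp)
  moreover have "ba_definable (Suc n) (\<lambda>e. B (\<lambda>i. e (Suc i)) (e 0))"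
    unfolding B_def by (rule sat) simp
  moreover have "ba_definable (Suc n) (\<lambda>e. F (\<lambda>i. e (Suc i)) (e 0) a b)" for a b
    unfolding F_def by (rule step) (use ok in \<open>simp add: ind_sym_ok_def\<close>)
  ultimately have "tree_definable n (\<lambda>e. tree_eval (B e) (F e) (d e) 1)"
    by (rule tree_definableI) simp
  moreover have "ba_definable n C"
    unfolding C_def
    by (intro ba_definable_conj ba_definable_not ba_definable_eq ba_definable_le pf term_fun_const
        term_fun_blen logarithmic_term_fun[OF L])
  ultimately have "tree_definable n (\<lambda>e. if C e then tree_eval (B e) (F e) (d e) 1 else False)"
    by (intro tree_definable_if tree_definable_ba[OF ba_definable_const])
  moreover have "(if C e then tree_eval (B e) (F e) (d e) 1 else False) = ind_holds S (map (tm_val e) ts) (tm_val e p)" for e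
  proof (cases "C e")
    case True
    have BF: "B e = (\<lambda>q. ba_sat ((!) (args e @ [path_append (tm_val e p) q])) (base S))"
      "F e = (\<lambda>q a b. bool_val (map (ba_sat ((!) (args e @ [path_append (tm_val e p) q]))) (side S)) a b (step S))"
      by (simp_all add: fun_eq_iff B_def F_def env_def)
    from True have "ind_holds S (args e) (tm_val e p) = tree_eval (\<lambda>q. ba_sat ((!) (args e @ [q])) (base S))
      (\<lambda>q a b. bool_val (map (ba_sat ((!) (args e @ [q]))) (side S)) a b (step S)) (d e) (tm_val e p)"
      by (intro ind_holds_tree_eval) (simp_all add: C_def d_def L_def)
    also have "\<dots> = tree_eval (B e) (F e) (d e) 1"
      using tree_eval_subtree[of 1 "\<lambda>q. ba_sat ((!) (args e @ [q])) (base S)" "tm_val e p"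
          "\<lambda>q a b. bool_val (map (ba_sat ((!) (args e @ [q]))) (side S)) a b (step S)"]
      by (simp add: path_append_1 BF)
    finally show ?thesis using True by (simp add: args_def)
  next
    case False
    then show ?thesis
      by (subst ind_holds.simps) (auto simp: C_def L_def args_def blen_eq_0_iff)
  qed
  ultimately show ?thesis by simp
qed

text \<open>A normal form: nested sharply bounded quantifiers and inductive predicates collapse to one tree.\<close>

theorem aid_formula_tree_definable:
  assumes "aid_formula n F" and "Sigma0b F"
  shows "tree_definable n (\<lambda>e. aid_sat e F)"
  using assms
proof (induction F arbitrary: n)
  case (Atom a)
  show ?case
  proof (cases a)
    case (BA b)
    have "ba_definable n (\<lambda>e. ba_sat e (Atom b))"
      using Atom.prems BA unfolding ba_definable_def by (intro exI[of _ "Atom b"]) simp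
    then show ?thesis using BA tree_definable_ba by simp
  next
    case (Ind S ts p)
    then show ?thesis using Atom.prems tree_definable_ind[of S ts n p] by simp
  qed
next
  case (Neg F)
  then show ?case by (simp add: tree_definable_not)
next
  case (And F G)
  then show ?case by (simp add: tree_definable_conj)
next
  case (Or F G)
  then have "tree_definable n (\<lambda>e. \<not> (\<not> aid_sat e F \<and> \<not> aid_sat e G))"
    by (intro tree_definable_not tree_definable_conj) simp_all
  then show ?case by simp
next
  case (Imp F G)
  then have "tree_definable n (\<lambda>e. \<not> (aid_sat e F \<and> \<not> aid_sat e G))"
    by (intro tree_definable_not tree_definable_conj) simp_all
  then show ?case by simp
next
  case (BAll t F)
  then obtain s where s: "t = Len s" "tm_below n s" by auto
  have "tree_definable (Suc n) (\<lambda>e. \<not> aid_sat (case_nat (e 0) (\<lambda>i. e (Suc i))) F)"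
    unfolding case_nat_0_Suc by (intro tree_definable_not BAll.IH) (use BAll.prems in simp_all)
  moreover have "term_fun n (\<lambda>e. tm_val e s)" using s(2) unfolding term_fun_def by auto
  ultimately have "tree_definable n (\<lambda>e. \<not> (\<exists>v \<le> \<bar>tm_val e s\<bar>\<^sub>b. \<not> aid_sat (case_nat v e) F))"
    by (intro tree_definable_not) (rule tree_definable_bex)
  then show ?case by (simp add: s(1))
next
  case (BEx t F)
  then obtain s where s: "t = Len s" "tm_below n s" by auto
  have "tree_definable (Suc n) (\<lambda>e. aid_sat (case_nat (e 0) (\<lambda>i. e (Suc i))) F)"
    unfolding case_nat_0_Suc by (intro BEx.IH) (use BEx.prems in simp_all)
  moreover have "term_fun n (\<lambda>e. tm_val e s)" using s(2) unfolding term_fun_def by auto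
  ultimately have "tree_definable n (\<lambda>e. \<exists>v \<le> \<bar>tm_val e s\<bar>\<^sub>b. aid_sat (case_nat v e) F)"
    by (rule tree_definable_bex)
  then show ?case by (simp add: s(1))
qed simp_all

text \<open>A gate is a function of two truth values, so it is a boolean formula in \<open>p\<^sub>0\<close>, \<open>p\<^sub>1\<close> and four side
formulae, one for each row of its truth table. The offset of the linear form is increased by one
because the root is the path 1, which has length 1.\<close>

theorem tree_definable_imp_ind:
  assumes "tree_definable n R"
  shows "\<exists>S. ind_sym_ok S \<and> ind_arity S = n \<and> (\<forall>xs. length xs = n \<longrightarrow> (R ((!) xs) \<longleftrightarrow> ind_holds S xs 1))"
proof -
  obtain d where d: "logarithmic n d"
    and pad: "\<And>l. logarithmic n l \<Longrightarrow> (\<And>e. d e \<le> l e) \<Longrightarrow> \<exists>B F.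
      ba_definable (Suc n) (\<lambda>e. B (\<lambda>i. e (Suc i)) (e 0)) \<and>
      (\<forall>a b. ba_definable (Suc n) (\<lambda>e. F (\<lambda>i. e (Suc i)) (e 0) a b)) \<and>
      (\<forall>e. R e \<longleftrightarrow> tree_eval (B e) (F e) (l e) 1)"
    using tree_definable_pad[OF assms] by blast
  obtain l where l: "lin_len n l" "\<And>e. d e \<le> l e" using d unfolding logarithmic_def by blast
  obtain c k where ck: "\<And>e. l e = (\<Sum>i<n. c i * \<bar>\<bar>e i\<bar>\<^sub>b\<bar>\<^sub>b) + k" using l(1) unfolding lin_len_def by blast
  obtain B F where B: "ba_definable (Suc n) (\<lambda>e. B (\<lambda>i. e (Suc i)) (e 0))"
    and F: "\<And>a b. ba_definable (Suc n) (\<lambda>e. F (\<lambda>i. e (Suc i)) (e 0) a b)"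
    and R: "\<And>e. R e \<longleftrightarrow> tree_eval (B e) (F e) (l e) 1"
    using pad[OF lin_len_logarithmic[OF l(1)] l(2)] by blast
  have "ba_definable (Suc n) (\<lambda>e. B e (e n))"
    by (rule ba_definable_at[OF B]) (simp_all add: term_fun_var)
  then obtain fB where fB: "ba_formula (Suc n) fB" "Sigma0b fB" "\<And>e. ba_sat e fB = B e (e n)"
    unfolding ba_definable_def by blast
  have "\<exists>G. ba_formula (Suc n) G \<and> Sigma0b G \<and> (\<forall>e. ba_sat e G = F e (e n) a b)" for a b
    using ba_definable_at[of n "\<lambda>e p. F e p a b", OF F] unfolding ba_definable_def by (simp add: term_fun_var)
  then obtain fF where fF: "\<And>a b. ba_formula (Suc n) (fF a b)" "\<And>a b. Sigma0b (fF a b)"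
      "\<And>a b e. ba_sat e (fF a b) = F e (e n) a b" by metis
  define S where "S = IndSym (Lin (map c [0..<n]) (Suc k)) fB [fF False False, fF False True, fF True False, fF True True]
    (BOr (BOr (BAnd (BAnd (BNot P0) (BNot P1)) (D 0)) (BAnd (BAnd (BNot P0) P1) (D 1)))
         (BOr (BAnd (BAnd P0 (BNot P1)) (D 2)) (BAnd (BAnd P0 P1) (D 3))))"
  have "ind_sym_ok S" "ind_arity S = n"
    using fB fF by (auto simp: ind_sym_ok_def S_def ind_arity_def)
  moreover have "R ((!) xs) \<longleftrightarrow> ind_holds S xs 1" if xs: "length xs = n" for xs
  proof -
    have env: "(!) (xs @ [p]) i = (!) xs i" if "i < n" for i p using that xs by (simp add: nth_append)
    have last: "(xs @ [p]) ! n = p" for p using xs by (simp add: nth_append)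
    have agree: "case_nat p ((!) (xs @ [p])) i = case_nat p ((!) xs) i" if "i < Suc n" for i p
      using that env by (cases i) simp_all
    have B': "B ((!) (xs @ [p])) p = B ((!) xs) p" for p
      using ba_definable_cong[OF B, of "case_nat p ((!) (xs @ [p]))" "case_nat p ((!) xs)"] agree by simp
    have F': "F ((!) (xs @ [p])) p a b = F ((!) xs) p a b" for p a b
      using ba_definable_cong[OF F, of "case_nat p ((!) (xs @ [p]))" "case_nat p ((!) xs)"] agree by simp
    have "lin_val (lform S) xs = Suc (l ((!) xs))"
      using xs by (subst lin_val_eq_sum) (simp_all add: S_def ck)
    then have "ind_holds S xs 1 \<longleftrightarrow> tree_eval (\<lambda>p. ba_sat ((!) (xs @ [p])) (base S))
        (\<lambda>p a b. bool_val (map (ba_sat ((!) (xs @ [p]))) (side S)) a b (step S)) (l ((!) xs)) 1"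
      by (intro ind_holds_tree_eval) simp_all
    also have "\<dots> \<longleftrightarrow> tree_eval (B ((!) xs)) (F ((!) xs)) (l ((!) xs)) 1"
    proof (rule tree_eval_cong)
      show "ba_sat ((!) (xs @ [p])) (base S) = B ((!) xs) p" for p
        by (simp add: S_def fB last B')
      show "bool_val (map (ba_sat ((!) (xs @ [p]))) (side S)) a b (step S) = F ((!) xs) p a b" for p a b
        by (cases a; cases b) (simp_all add: S_def fF last F' numeral_2_eq_2 numeral_3_eq_3)
    qed simp
    finally show ?thesis using R by simp
  qed
  ultimately show ?thesis by blast
qed

section \<open>Counting on logarithmically short ranges\<close>

lemma ex_word:
  fixes P :: "nat \<Rightarrow> bool"
  shows "\<exists>w < 2 ^ m. \<forall>i. bit (w :: nat) i \<longleftrightarrow> i < m \<and> P i"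
proof -
  define w :: nat where "w = horner_sum of_bool 2 (map P [0..<m])"
  have bits: "bit w i \<longleftrightarrow> i < m \<and> P i" for i
    unfolding w_def bit_horner_sum_bit_iff by (cases "i < m") simp_all
  have "take_bit m w = w"
    by (rule bit_eqI) (simp only: bit_take_bit_iff bits, blast)
  then have "w < 2 ^ m" using take_bit_nat_less_exp[of m w] by argo
  then show ?thesis using bits by (intro exI[of _ w]) (rule conjI, assumption, rule allI)
qed

lemma sum_bits: "x = (\<Sum>i | bit x i. 2 ^ i)" for x :: nat
proof -
  have "x = part x 0 \<bar>x\<bar>\<^sub>b" by (simp add: part_upto_blen)
  also have "\<dots> = (\<Sum>i<\<bar>x\<bar>\<^sub>b. of_bool (bit x i) * 2 ^ i)" by (simp add: part_def atLeast0LessThan)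
  also have "\<dots> = (\<Sum>i | bit x i. 2 ^ i)"
    by (rule sum.mono_neutral_cong_right) (auto dest: bit_imp_less_blen)
  finally show ?thesis .
qed

text \<open>Casting out \<open>2\<^sup>b - 1\<close>: since \<open>2\<^bsup>bj\<^esup> \<equiv> 1\<close>, a sum of such powers is congruent to the number of summands.
The congruence is written as \<open>w + q = q\<cdot>2\<^sup>b + c\<close> because that needs a shift but no multiplication.\<close>

lemma casting_out:
  fixes A :: "nat set"
  assumes "finite A" and "\<And>i. i \<in> A \<Longrightarrow> b dvd i"
  shows "\<exists>q. (\<Sum>i\<in>A. 2 ^ i) + q = q * 2 ^ b + card A"
  using assms
proof (induction A rule: finite_induct)
  case empty
  then show ?case by (intro exI[of _ 0]) simp
next
  case (insert i A)
  then obtain q where q: "(\<Sum>i\<in>A. 2 ^ i) + q = q * 2 ^ b + card A" by auto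
  have geo: "\<exists>s. 2 ^ (b * j) + s = s * 2 ^ b + (1::nat)" for j
  proof (induction j)
    case 0
    show ?case by (intro exI[of _ 0]) simp
  next
    case (Suc j)
    then obtain s where "2 ^ (b * j) + s = s * 2 ^ b + (1::nat)" by blast
    moreover have "(2::nat) ^ (b * Suc j) = 2 ^ (b * j) * 2 ^ b" by (simp add: power_add mult.commute)
    moreover have "(s + 2 ^ (b * j)) * 2 ^ b = s * 2 ^ b + 2 ^ (b * j) * 2 ^ b" by (rule distrib_right)
    ultimately have "2 ^ (b * Suc j) + (s + 2 ^ (b * j)) = (s + 2 ^ (b * j)) * 2 ^ b + 1" by linarith
    then show ?case by blast
  qed
  obtain j where "i = b * j" using insert.prems[of i] by auto
  with geo[of j] obtain s where s: "2 ^ i + s = s * 2 ^ b + (1::nat)" by blast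
  have "(\<Sum>i\<in>insert i A. 2 ^ i) + (q + s) = (q + s) * 2 ^ b + card (insert i A)"
    using q s insert.hyps by (simp add: algebra_simps)
  then show ?case by blast
qed

lemma casting_out_unique:
  fixes w q c b :: nat
  assumes "w + q = q * 2 ^ b + c" and "c < 2 ^ b - 1"
  shows "c = w mod (2 ^ b - 1)"
proof -
  obtain B where B: "2 ^ b = Suc B" using not0_implies_Suc[of "2 ^ b"] by auto
  then have "w = q * B + c" using assms(1) by simp
  then show ?thesis using assms(2) B by simp
qed

text \<open>Small numbers can be stored as consecutive fields of width \<open>b\<close> in one word.\<close>

lemma ex_fields:
  fixes f :: "nat \<Rightarrow> nat"
  assumes "\<And>j. j < N \<Longrightarrow> f j < 2 ^ b"
  shows "\<exists>V < 2 ^ (N * b). \<forall>j<N. part V (j * b) (j * b + b) = f j"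
proof -
  obtain V :: nat where V: "V < 2 ^ (N * b)" "\<And>i. bit V i \<longleftrightarrow> i < N * b \<and> bit (f (i div b)) (i mod b)"
    using ex_word[of "N * b" "\<lambda>i. bit (f (i div b)) (i mod b)"] by blast
  have "part V (j * b) (j * b + b) = f j" if j: "j < N" for j
  proof (rule bit_eqI)
    fix t
    show "bit (part V (j * b) (j * b + b)) t \<longleftrightarrow> bit (f j) t"
    proof (cases "t < b")
      case True
      have "j * b + t < Suc j * b" using True by simp
      also have "\<dots> \<le> N * b" using j by (intro mult_right_mono) simp_all
      finally have "j * b + t < N * b" .
      then show ?thesis using True by (simp add: part_eq_take_drop_bit bit_take_bit_iff bit_drop_bit_eq V(2))
    next
      case False
      have "\<bar>f j\<bar>\<^sub>b \<le> b" using assms[OF j] by (simp add: blen_le_iff)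
      then have "\<not> bit (f j) t" using bit_imp_less_blen[of "f j" t] False by linarith
      then show ?thesis using False by (simp add: part_eq_take_drop_bit bit_take_bit_iff)
    qed
  qed
  with V(1) show ?thesis by blast
qed

lemma card_residue_classes:
  fixes k b :: nat
  assumes "b > 0"
  shows "card {i. i < k \<and> P i} = (\<Sum>r<b. card {i. i < k \<and> b dvd i \<and> i + r < k \<and> P (i + r)})"
proof -
  have "card {i. i < k \<and> P i} = (\<Sum>r<b. \<Sum>i | i \<in> {i. i < k \<and> P i} \<and> i mod b = r. 1)"
    using assms by (subst sum.group) auto
  also have "\<dots> = (\<Sum>r<b. card {i. i < k \<and> b dvd i \<and> i + r < k \<and> P (i + r)})"
  proof (rule sum.cong[OF refl])
    fix r assume "r \<in> {..<b}"
    then have r: "r < b" by simp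
    have "bij_betw (\<lambda>i. i + r) {i. i < k \<and> b dvd i \<and> i + r < k \<and> P (i + r)} {i. (i < k \<and> P i) \<and> i mod b = r}"
    proof (rule bij_betw_byWitness[where f' = "\<lambda>i. i - r"])
      show "(\<lambda>i. i + r) ` {i. i < k \<and> b dvd i \<and> i + r < k \<and> P (i + r)} \<subseteq> {i. (i < k \<and> P i) \<and> i mod b = r}"
        using r by (auto simp: dvd_def mod_mult_self4)
      show "(\<lambda>i. i - r) ` {i. (i < k \<and> P i) \<and> i mod b = r} \<subseteq> {i. i < k \<and> b dvd i \<and> i + r < k \<and> P (i + r)}"
      proof
        fix j assume "j \<in> (\<lambda>i. i - r) ` {i. (i < k \<and> P i) \<and> i mod b = r}"
        then obtain i where i: "j = i - r" "i < k" "P i" "i mod b = r" by blast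
        then have "r \<le> i" "b dvd j" by (auto simp: minus_mod_eq_mult_div)
        with i show "j \<in> {i. i < k \<and> b dvd i \<and> i + r < k \<and> P (i + r)}" by simp
      qed
    qed auto
    then show "(\<Sum>i | i \<in> {i. i < k \<and> P i} \<and> i mod b = r. 1) = card {i. i < k \<and> b dvd i \<and> i + r < k \<and> P (i + r)}"
      by (simp add: bij_betw_same_card)
  qed
  finally show ?thesis .
qed

text \<open>With \<open>b = |k| + 1\<close>, a word with \<open>b + 1\<close> fields of width \<open>b\<close> has length at most linear in \<open>k\<close>.\<close>

lemma field_width_bound: "Suc (Suc \<bar>k\<bar>\<^sub>b) * Suc \<bar>k\<bar>\<^sub>b \<le> 6 * k + 2"
proof (cases "\<bar>k\<bar>\<^sub>b")
  case (Suc m)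
  have "(m + 3) * (m + 2) \<le> 6 * 2 ^ m + 2"
  proof (induction m)
    case (Suc m)
    have "m + 1 \<le> 2 ^ m" using less_exp[of m] by linarith
    moreover have "(m + 4) * (m + 3) = (m + 3) * (m + 2) + 2 * m + 6" by (simp add: distrib_left distrib_right)
    ultimately have "(m + 4) * (m + 3) \<le> 6 * (2 * 2 ^ m) + 2" using Suc by linarith
    moreover have "Suc m + 3 = m + 4" "Suc m + 2 = m + 3" by simp_all
    ultimately show ?case unfolding power_Suc by argo
  qed simp
  moreover have "2 ^ m \<le> k" unfolding less_blen_iff[symmetric] Suc by simp
  ultimately have "(m + 3) * (m + 2) \<le> 6 * k + 2" by linarith
  moreover have "Suc (Suc (Suc m)) = m + 3" "Suc (Suc m) = m + 2" by simp_all
  ultimately show ?thesis unfolding Suc by argo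
qed simp

text \<open>A number of prescribed length \<open>a \<le> |Y|\<close>. Lengths are what \<open>#\<close> multiplies and what shifts shift by, so
this makes small numbers available as arguments of both.\<close>

definition prefix_of_len :: "nat \<Rightarrow> nat \<Rightarrow> nat" where
  "prefix_of_len Y a = part Y (\<bar>Y\<bar>\<^sub>b - a) \<bar>Y\<bar>\<^sub>b"

lemma blen_prefix_of_len: "a \<le> \<bar>Y\<bar>\<^sub>b \<Longrightarrow> \<bar>prefix_of_len Y a\<bar>\<^sub>b = a"
  unfolding prefix_of_len_def part_upto_blen blen_div_power by simp

text \<open>Multiplication of small numbers, by \<open>|x#y| = |x||y| + 1\<close>.\<close>

definition short_mult :: "nat \<Rightarrow> nat \<Rightarrow> nat \<Rightarrow> nat" where
  "short_mult Y a b = \<bar>smash (prefix_of_len Y a) (prefix_of_len Y b)\<bar>\<^sub>b - 1"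

lemma short_mult_eq: "a \<le> \<bar>Y\<bar>\<^sub>b \<Longrightarrow> b \<le> \<bar>Y\<bar>\<^sub>b \<Longrightarrow> short_mult Y a b = a * b"
  by (simp add: short_mult_def blen_smash blen_prefix_of_len)

lemma term_fun_prefix_of_len:
  "term_fun n Y \<Longrightarrow> term_fun n a \<Longrightarrow> term_fun n (\<lambda>e. prefix_of_len (Y e) (a e))"
  unfolding prefix_of_len_def by (intro term_fun_intros)

lemma term_fun_short_mult:
  "term_fun n Y \<Longrightarrow> term_fun n a \<Longrightarrow> term_fun n b \<Longrightarrow> term_fun n (\<lambda>e. short_mult (Y e) (a e) (b e))"
  unfolding short_mult_def by (intro term_fun_intros term_fun_prefix_of_len)

lemma term_fun_rename:
  assumes "term_fun n f" and "\<And>i. i < n \<Longrightarrow> h i < m"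
  shows "term_fun m (\<lambda>e. f (\<lambda>i. e (h i)))"
  by (rule term_fun_subst[where f = "\<lambda>e i. e (h i)", OF assms(1)]) (simp add: term_fun_var assms(2))

lemma logarithmic_rename:
  assumes "logarithmic n f" and "\<And>i. i < n \<Longrightarrow> h i < m"
  shows "logarithmic m (\<lambda>e. f (\<lambda>i. e (h i)))"
  by (rule logarithmic_subst[where f = "\<lambda>e i. e (h i)", OF assms(1)]) (simp add: term_fun_var assms(2))

lemma ba_definable_rename:
  assumes "ba_definable (Suc n) (\<lambda>e. P (e 0) (\<lambda>i. e (Suc i)))"
    and "term_fun m t" and "\<And>i. i < n \<Longrightarrow> h i < m"
  shows "ba_definable m (\<lambda>e. P (t e) (\<lambda>i. e (h i)))"
  by (rule ba_definable_at[where B = "\<lambda>e p. P p e" and f = "\<lambda>e i. e (h i)", OF assms(1,2)])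
    (simp add: term_fun_var assms(3))

text \<open>The number of \<open>i\<close> in one residue class: \<open>w\<close> collects the positions \<open>i + r\<close> with \<open>b | i\<close> and \<open>P (i + r)\<close>,
at bit \<open>i\<close>, for \<open>b = |k| + 1\<close>, and \<open>c\<close> is its number of bits by casting out \<open>2\<^sup>b - 1\<close>. As \<open>k < 2\<^sup>b - 1\<close>,
the congruence determines \<open>c \<le> k\<close>.\<close>

definition count_witness :: "(nat \<Rightarrow> bool) \<Rightarrow> nat \<Rightarrow> nat \<Rightarrow> nat \<Rightarrow> nat \<Rightarrow> bool" where
  "count_witness P k Y r c \<longleftrightarrow> (\<exists>w < 2 ^ k. \<exists>q < 2 ^ k.
     (\<forall>i<k. bit w i \<longleftrightarrow> (\<exists>j < Suc k. i = short_mult Y j (Suc \<bar>k\<bar>\<^sub>b)) \<and> i + r < k \<and> P (i + r)) \<and>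
     w + q = q * 2 ^ \<bar>prefix_of_len Y (Suc \<bar>k\<bar>\<^sub>b)\<bar>\<^sub>b + c)"

lemma count_witness_iff:
  assumes Y: "Suc k \<le> \<bar>Y\<bar>\<^sub>b" and c: "c \<le> k"
  shows "count_witness P k Y r c \<longleftrightarrow>
    c = card {i. i < k \<and> Suc \<bar>k\<bar>\<^sub>b dvd i \<and> i + r < k \<and> P (i + r)}"
proof -
  define b where "b = Suc \<bar>k\<bar>\<^sub>b"
  define A where "A = {i. i < k \<and> b dvd i \<and> i + r < k \<and> P (i + r)}"
  have bY: "b \<le> \<bar>Y\<bar>\<^sub>b" using Y blen_le_self[of k] by (simp add: b_def)
  have small: "x < 2 ^ b - 1" if "x \<le> k" for x
    using less_two_power_blen[of k] that by (simp add: b_def)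
  have cardA: "card A \<le> k"
    using card_mono[of "{..<k}" A] by (auto simp: A_def)
  have mult: "(\<exists>j < Suc k. i = short_mult Y j b) \<longleftrightarrow> b dvd i" if "i < k" for i
  proof
    assume "\<exists>j < Suc k. i = short_mult Y j b"
    then obtain j where "j < Suc k" "i = short_mult Y j b" by blast
    then have "i = j * b" using short_mult_eq[of j Y b] Y bY by simp
    then show "b dvd i" by simp
  next
    assume "b dvd i"
    then obtain j where j: "i = b * j" by blast
    have "j \<le> b * j" by (simp add: b_def)
    then have "j < Suc k" using j that by linarith
    moreover have "i = short_mult Y j b" using short_mult_eq[of j Y b] Y bY j \<open>j < Suc k\<close> by simp
    ultimately show "\<exists>j < Suc k. i = short_mult Y j b" by blast
  qed
  have word: "{i. bit w i} = A" if "w < 2 ^ k" "\<forall>i<k. bit w i \<longleftrightarrow> i \<in> A" for w :: nat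
  proof -
    have "\<bar>w\<bar>\<^sub>b \<le> k" using that(1) by (simp add: blen_le_iff)
    then have "i < k" if "bit w i" for i using bit_imp_less_blen[OF that] by linarith
    moreover have "i < k" if "i \<in> A" for i using that by (simp add: A_def)
    ultimately show ?thesis using that(2) by blast
  qed
  have fin: "finite A" by (simp add: A_def)
  have dvd: "b dvd i" if "i \<in> A" for i using that by (simp add: A_def)
  obtain q0 where q0: "(\<Sum>i\<in>A. 2 ^ i) + q0 = q0 * 2 ^ b + card A" using casting_out[OF fin dvd] by blast
  have inA: "(\<exists>j < Suc k. i = short_mult Y j b) \<and> i + r < k \<and> P (i + r) \<longleftrightarrow> i \<in> A" if "i < k" for i
    using mult[OF that] that by (simp add: A_def)
  have "count_witness P k Y r c \<longleftrightarrow> (\<exists>w < 2 ^ k. \<exists>q < 2 ^ k. (\<forall>i<k. bit w i \<longleftrightarrow> i \<in> A) \<and> w + q = q * 2 ^ b + c)"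
    unfolding count_witness_def b_def[symmetric] blen_prefix_of_len[OF bY] using inA by simp
  also have "\<dots> \<longleftrightarrow> c = card A"
  proof
    assume "\<exists>w < 2 ^ k. \<exists>q < 2 ^ k. (\<forall>i<k. bit w i \<longleftrightarrow> i \<in> A) \<and> w + q = q * 2 ^ b + c"
    then obtain w q where w: "w < 2 ^ k" "\<forall>i<k. bit w i \<longleftrightarrow> i \<in> A" "w + q = q * 2 ^ b + c" by blast
    have "w = (\<Sum>i\<in>A. 2 ^ i)" using sum_bits[of w] word[OF w(1,2)] by simp
    then have "card A = w mod (2 ^ b - 1)"
      using casting_out_unique[of w q0 b "card A"] q0 small[OF cardA] by simp
    then show "c = card A" using casting_out_unique[OF w(3) small[OF c]] by simp
  next
    assume c: "c = card A"
    obtain w :: nat where w: "w < 2 ^ k" "\<And>i. bit w i \<longleftrightarrow> i < k \<and> i \<in> A" using ex_word[of k "\<lambda>i. i \<in> A"] by blast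
    have "w = (\<Sum>i\<in>A. 2 ^ i)" using sum_bits[of w] word[OF w(1)] w(2) by simp
    then have eq: "w + q0 = q0 * 2 ^ b + c" using q0 c by simp
    have "2 * q0 \<le> q0 * 2 ^ b" by (simp add: b_def)
    then have "q0 < 2 ^ k" using eq w(1) by linarith
    with w eq show "\<exists>w < 2 ^ k. \<exists>q < 2 ^ k. (\<forall>i<k. bit w i \<longleftrightarrow> i \<in> A) \<and> w + q = q * 2 ^ b + c" by blast
  qed
  finally show ?thesis unfolding A_def b_def .
qed

text \<open>The residue classes are added up by guessing all partial sums at once, as the fields of a word \<open>V\<close>.\<close>

definition count_formula :: "(nat \<Rightarrow> bool) \<Rightarrow> nat \<Rightarrow> nat \<Rightarrow> nat \<Rightarrow> bool" where
  "count_formula P k Y v \<longleftrightarrow> (\<exists>V < 2 ^ (6 * k + 2).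
     part V 0 (Suc \<bar>k\<bar>\<^sub>b) = 0 \<and>
     part V (short_mult Y (Suc \<bar>k\<bar>\<^sub>b) (Suc \<bar>k\<bar>\<^sub>b)) (short_mult Y (Suc \<bar>k\<bar>\<^sub>b) (Suc \<bar>k\<bar>\<^sub>b) + Suc \<bar>k\<bar>\<^sub>b) = v \<and>
     (\<forall>r < Suc \<bar>k\<bar>\<^sub>b. \<exists>c < Suc k. count_witness P k Y r c \<and>
       part V (short_mult Y (Suc r) (Suc \<bar>k\<bar>\<^sub>b)) (short_mult Y (Suc r) (Suc \<bar>k\<bar>\<^sub>b) + Suc \<bar>k\<bar>\<^sub>b) =
       part V (short_mult Y r (Suc \<bar>k\<bar>\<^sub>b)) (short_mult Y r (Suc \<bar>k\<bar>\<^sub>b) + Suc \<bar>k\<bar>\<^sub>b) + c))"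

lemma count_formula_iff:
  assumes Y: "Suc k \<le> \<bar>Y\<bar>\<^sub>b"
  shows "count_formula P k Y v \<longleftrightarrow> card {i. i < k \<and> P i} = v"
proof -
  define b where "b = Suc \<bar>k\<bar>\<^sub>b"
  have bY: "b \<le> \<bar>Y\<bar>\<^sub>b" using Y blen_le_self[of k] by (simp add: b_def)
  define cnt where "cnt r = card {i. i < k \<and> b dvd i \<and> i + r < k \<and> P (i + r)}" for r
  have cnt_le: "cnt r \<le> k" for r
    unfolding cnt_def using card_mono[of "{..<k}" "{i. i < k \<and> b dvd i \<and> i + r < k \<and> P (i + r)}"] by auto
  have total: "card {i. i < k \<and> P i} = (\<Sum>r<b. cnt r)"
    unfolding cnt_def by (rule card_residue_classes) (simp add: b_def)
  have wit: "(\<exists>c < Suc k. count_witness P k Y r c \<and> x = y + c) \<longleftrightarrow> x = y + cnt r" for r x y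
    using count_witness_iff[OF Y, of _ P r] cnt_le[of r] unfolding cnt_def b_def by (auto simp: less_Suc_eq_le)
  have mult: "short_mult Y j b = j * b" if "j \<le> b" for j
    using short_mult_eq[of j Y b] bY that by simp
  have "count_formula P k Y v \<longleftrightarrow> (\<exists>V < 2 ^ (6 * k + 2). part V 0 b = 0 \<and> part V (b * b) (b * b + b) = v \<and>
     (\<forall>r<b. part V (Suc r * b) (Suc r * b + b) = part V (r * b) (r * b + b) + cnt r))"
    unfolding count_formula_def b_def[symmetric] wit using mult by simp
  also have "\<dots> \<longleftrightarrow> (\<Sum>r<b. cnt r) = v"
  proof
    assume "\<exists>V < 2 ^ (6 * k + 2). part V 0 b = 0 \<and> part V (b * b) (b * b + b) = v \<and>
     (\<forall>r<b. part V (Suc r * b) (Suc r * b + b) = part V (r * b) (r * b + b) + cnt r)"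
    then obtain V where V: "part V 0 b = 0" "part V (b * b) (b * b + b) = v"
      "\<And>r. r < b \<Longrightarrow> part V (Suc r * b) (Suc r * b + b) = part V (r * b) (r * b + b) + cnt r" by blast
    have "part V (j * b) (j * b + b) = (\<Sum>r<j. cnt r)" if "j \<le> b" for j
      using that
    proof (induction j)
      case 0
      then show ?case using V(1) by simp
    next
      case (Suc j)
      then show ?case using V(3)[of j] by simp
    qed
    from this[of b] show "(\<Sum>r<b. cnt r) = v" using V(2) by simp
  next
    assume v: "(\<Sum>r<b. cnt r) = v"
    have "(\<Sum>r<j. cnt r) < 2 ^ b" if "j < Suc b" for j
    proof -
      have "(\<Sum>r<j. cnt r) \<le> (\<Sum>r<b. cnt r)" using that by (intro sum_mono2) auto
      also have "\<dots> \<le> k" using total card_mono[of "{..<k}" "{i. i < k \<and> P i}"] by auto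
      also have "\<dots> < 2 ^ b" using less_two_power_blen[of k] by (simp add: b_def)
      finally show ?thesis .
    qed
    then obtain V where V: "V < 2 ^ (Suc b * b)" "\<forall>j<Suc b. part V (j * b) (j * b + b) = (\<Sum>r<j. cnt r)"
      using ex_fields[of "Suc b" "\<lambda>j. \<Sum>r<j. cnt r" b] by blast
    have "Suc b * b \<le> 6 * k + 2" using field_width_bound[of k] by (simp only: b_def)
    then have "(2::nat) ^ (Suc b * b) \<le> 2 ^ (6 * k + 2)" by (rule power_increasing) simp
    with V(1) have "V < 2 ^ (6 * k + 2)" by linarith
    moreover have "part V 0 b = 0" using V(2)[rule_format, of 0] by simp
    moreover have "part V (b * b) (b * b + b) = v" using V(2)[rule_format, of b] v by simp
    moreover have "\<forall>r<b. part V (Suc r * b) (Suc r * b + b) = part V (r * b) (r * b + b) + cnt r"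
    proof (intro allI impI)
      fix r assume "r < b"
      then show "part V (Suc r * b) (Suc r * b + b) = part V (r * b) (r * b + b) + cnt r"
        using V(2)[rule_format, of r] V(2)[rule_format, of "Suc r"] by simp
    qed
    ultimately show "\<exists>V < 2 ^ (6 * k + 2). part V 0 b = 0 \<and> part V (b * b) (b * b + b) = v \<and>
     (\<forall>r<b. part V (Suc r * b) (Suc r * b + b) = part V (r * b) (r * b + b) + cnt r)" by blast
  qed
  finally show ?thesis using total by simp
qed

text \<open>The word that \<open>count_formula\<close> guesses has length at most \<open>6k + 2\<close>, which is logarithmic together with \<open>k\<close>.\<close>

lemma ba_definable_card:
  assumes P: "ba_definable (Suc n) (\<lambda>e. P (e 0) (\<lambda>i. e (Suc i)))"
    and k: "logarithmic n k" and v: "term_fun n v"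
  shows "ba_definable n (\<lambda>e. card {i. i < k e \<and> P i e} = v e)"
proof -
  obtain Y where Y: "term_fun n Y" "\<And>e. 2 ^ k e \<le> \<bar>Y e\<bar>\<^sub>b" using exp_logarithmic_bound[OF k] by blast
  have "ba_definable n (\<lambda>e. count_formula (\<lambda>i. P i e) (k e) (Y e) (v e))"
    unfolding count_formula_def count_witness_def
    by (intro ba_definable_conj ba_definable_iff ba_definable_eq ba_definable_less ba_definable_bit
        ba_definable_bex_word ba_definable_bex_less ba_definable_ball_less
        ba_definable_rename[where P = P, OF P] logarithmic_rename[OF k] k
        logarithmic_Suc logarithmic_plus logarithmic_mult_const logarithmic_const logarithmic_blen
        term_fun_short_mult term_fun_prefix_of_len term_fun_part term_fun_shift term_fun_plus term_fun_Suc
        term_fun_const term_fun_blen term_fun_rename[OF Y(1)] Y(1)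
        term_fun_rename[OF v] v term_fun_rename[OF logarithmic_term_fun[OF k]] logarithmic_term_fun[OF k]
        term_fun_var) simp_all
  moreover have "count_formula (\<lambda>i. P i e) (k e) (Y e) (v e) \<longleftrightarrow> card {i. i < k e \<and> P i e} = v e" for e
  proof (rule count_formula_iff)
    show "Suc (k e) \<le> \<bar>Y e\<bar>\<^sub>b" using Y(2)[of e] less_exp[of "k e"] by linarith
  qed
  ultimately show ?thesis by simp
qed

section \<open>Ripple-carry addition\<close>

text \<open>The carry into position \<open>r\<close> in the addition of \<open>x\<close> and \<open>y\<close>.\<close>

definition carry :: "nat \<Rightarrow> nat \<Rightarrow> nat \<Rightarrow> bool" where
  "carry r x y \<longleftrightarrow> 2 ^ r \<le> x mod 2 ^ r + y mod 2 ^ r"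

lemma carry_0: "\<not> carry 0 x y"
  by (simp add: carry_def)

lemma mod_power_Suc: "(x::nat) mod 2 ^ Suc r = x mod 2 ^ r + of_bool (bit x r) * 2 ^ r"
  using take_bit_Suc_from_most[of r x] unfolding take_bit_eq_mod by simp

lemma carry_Suc:
  "carry (Suc r) x y \<longleftrightarrow> bit x r \<and> bit y r \<or> carry r x y \<and> (bit x r \<or> bit y r)"
proof -
  have "x mod 2 ^ r < 2 ^ r" "y mod 2 ^ r < 2 ^ r" by simp_all
  then have "x mod 2 ^ r + y mod 2 ^ r < 2 * 2 ^ r" by linarith
  then show ?thesis
    unfolding carry_def mod_power_Suc by (cases "bit x r"; cases "bit y r") auto
qed

lemma bit_add: "bit (x + y) r \<longleftrightarrow> (bit x r \<noteq> bit y r) \<noteq> carry r x y" for x y :: nat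
proof -
  define a b where "a = x mod 2 ^ r" and "b = y mod 2 ^ r"
  have ab: "a < 2 ^ r" "b < 2 ^ r" by (simp_all add: a_def b_def)
  have "x + y = (x div 2 ^ r + y div 2 ^ r) * 2 ^ r + (a + b)"
    unfolding a_def b_def distrib_right
    using div_mult_mod_eq[of x "2 ^ r"] div_mult_mod_eq[of y "2 ^ r"] by linarith
  then have "(x + y) div 2 ^ r = x div 2 ^ r + y div 2 ^ r + (a + b) div 2 ^ r"
    by simp
  moreover have "(a + b) div 2 ^ r = of_bool (carry r x y)"
  proof (cases "carry r x y")
    case True
    then have "2 ^ r \<le> a + b" unfolding carry_def a_def b_def .
    moreover from this have "a + b - 2 ^ r < 2 ^ r" using ab by linarith
    ultimately show ?thesis using True le_div_geq[of "2 ^ r" "a + b"] by simp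
  next
    case False
    then show ?thesis by (simp add: carry_def a_def b_def)
  qed
  ultimately show ?thesis by (auto simp: bit_iff_odd)
qed

section \<open>The unrolled adder tree\<close>

text \<open>A move takes three steps in the binary tree, hence three bits of the path; move 0 is the last one. The
bit triples \<open>00?\<close> and \<open>110\<close> lead to the left summand, \<open>01?\<close> and \<open>111\<close> to the right one, \<open>10?\<close> to the
carry. Both summands have two triples because the majority formula
\<open>(x \<and> y) \<or> (c \<and> (x \<or> y))\<close> uses them twice.\<close>

definition descends :: "nat \<Rightarrow> nat \<Rightarrow> bool" where
  "descends p k \<longleftrightarrow> \<not> bit p (3 * k + 2) \<or> bit p (3 * k + 1)"

definition to_right :: "nat \<Rightarrow> nat \<Rightarrow> bool" where
  "to_right p k \<longleftrightarrow> (if bit p (3 * k + 2) then bit p (3 * k) else bit p (3 * k + 1))"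

text \<open>A node asks for a carry if the last move led to one. For the root, the number 1, this is false.\<close>

definition at_carry :: "nat \<Rightarrow> bool" where
  "at_carry p \<longleftrightarrow> bit p 2 \<and> \<not> bit p 1"

definition path_depth :: "nat \<Rightarrow> nat \<Rightarrow> nat" where
  "path_depth p i = (\<Sum>k<i. of_bool (descends p k))"

text \<open>The directions of all descents, as a binary number with the last descent as its lowest bit.\<close>

definition path_node :: "nat \<Rightarrow> nat \<Rightarrow> nat" where
  "path_node p i = (\<Sum>k<i. of_bool (descends p k \<and> to_right p k) * 2 ^ path_depth p k)"

text \<open>Paths of length 1 modulo 3 are those between two moves. A gate there is the outermost connective of
\<open>(x \<noteq> y) \<noteq> c\<close> or of \<open>(x \<and> y) \<or> (c \<and> (x \<or> y))\<close>, according to what the node asks for; the two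
layers below hold the inner connectives. Where these formulae have no connective, the gate copies its
left child.\<close>

definition adder_gate :: "nat \<Rightarrow> bool \<Rightarrow> bool \<Rightarrow> bool" where
  "adder_gate p a b \<longleftrightarrow>
    (if \<bar>p\<bar>\<^sub>b mod 3 = 1 then if bit p 2 \<and> \<not> bit p 1 then a \<or> b else a \<noteq> b
     else if \<bar>p\<bar>\<^sub>b mod 3 = 2 then if bit p 3 \<and> \<not> bit p 2 then a \<and> b else if bit p 0 then a else a \<noteq> b
     else if bit p 1 \<and> bit p 0 then a \<or> b else a)"

lemma bit_double:
  "\<not> bit (2 * p) 0" "bit (Suc (2 * p)) 0"
  "bit (2 * p) (Suc k) \<longleftrightarrow> bit p k" "bit (Suc (2 * p)) (Suc k) \<longleftrightarrow> bit p k" for p :: nat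
  by (simp_all add: bit_Suc bit_0)

text \<open>Appending three bits to a path makes each earlier move one move older.\<close>

lemma path_step:
  fixes p q :: nat
  assumes "\<And>k. bit q (k + 3) \<longleftrightarrow> bit p k"
  shows "path_depth q (Suc i) = of_bool (descends q 0) + path_depth p i"
    and "path_node q (Suc i) = of_bool (descends q 0 \<and> to_right q 0) + 2 ^ of_bool (descends q 0) * path_node p i"
proof -
  have shift: "bit q (3 * Suc k + c) = bit p (3 * k + c)" for k c
    using assms[of "3 * k + c"] by (simp add: algebra_simps)
  have desc: "descends q (Suc k) = descends p k" for k
    unfolding descends_def shift ..
  have right: "to_right q (Suc k) = to_right p k" for k
    unfolding to_right_def using shift[of k 0] shift[of k 1] shift[of k 2] by simp
  show depth: "path_depth q (Suc i) = of_bool (descends q 0) + path_depth p i" for i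
    unfolding path_depth_def sum.lessThan_Suc_shift desc ..
  have zero: "path_depth q 0 = 0" by (simp add: path_depth_def)
  show "path_node q (Suc i) = of_bool (descends q 0 \<and> to_right q 0) + 2 ^ of_bool (descends q 0) * path_node p i"
    unfolding path_node_def sum.lessThan_Suc_shift desc right depth zero sum_distrib_left
    by (simp add: power_add mult.left_commute)
qed

text \<open>The invariant of the adder tree, with \<open>r\<close> the number of moves left. The number \<open>M d u\<close> at a node \<open>u\<close> of
depth \<open>d\<close> is meant to be the count below that node, multiplied by \<open>2\<^bsup>h - d\<^esup>\<close>. With this scaling, bit \<open>r\<close>
of \<open>M\<close> at a node depends on bit \<open>r - 1\<close> at its children and on the carry into position \<open>r - 1\<close>, so
that all three moves lower \<open>r\<close> by one and no second counter is needed. The scaled numbers satisfy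
\<open>M d u = 2(M (d + 1) (2u) + M (d + 1) (2u + 1))\<close> above the leaves; the equation for
the half of \<open>M d u\<close> also holds at the leaves and below them, where paths with few carry moves lead.\<close>

lemma tree_eval_adder:
  fixes M :: "nat \<Rightarrow> nat \<Rightarrow> nat"
  assumes M: "\<And>d u. M d u div 2 = M (Suc d) (2 * u) + M (Suc d) (Suc (2 * u))"
    and B: "\<And>p. \<bar>p\<bar>\<^sub>b = Suc (3 * m) \<Longrightarrow> B p \<longleftrightarrow> \<not> at_carry p \<and> odd (M (path_depth p m) (path_node p m))"
    and "i + r = m" and "\<bar>p\<bar>\<^sub>b = Suc (3 * i)"
  shows "tree_eval B adder_gate (3 * r) p \<longleftrightarrow>
    (let d = path_depth p i; u = path_node p i in
     if at_carry p then carry r (M (Suc d) (2 * u)) (M (Suc d) (Suc (2 * u))) else bit (M d u) r)"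
  using assms(3,4)
proof (induction r arbitrary: i p)
  case 0
  then show ?case using B[of p] by (simp add: Let_def carry_0 bit_0)
next
  case (Suc r)
  define d u where "d = path_depth p i" and "u = path_node p i"
  define x y where "x = M (Suc d) (2 * u)" and "y = M (Suc d) (Suc (2 * u))"
  define T where "T = tree_eval B adder_gate (3 * r)"
  have p: "p \<noteq> 0" by (rule notI) (use Suc.prems in simp)
  define c where "c b q = of_bool b + 2 * q" for b :: bool and q :: nat
  have c_bit: "bit (c b q) 0 = b" "bit (c b q) (Suc k) = bit q k" for b q k
    by (cases b; simp add: c_def bit_double)+
  have c_len: "\<bar>c b q\<bar>\<^sub>b = Suc \<bar>q\<bar>\<^sub>b" and c_nz: "c b q \<noteq> 0" if "q \<noteq> 0" for b q
    using that by (cases b; simp add: c_def blen_double)+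
  have unfold: "tree_eval B adder_gate (Suc k) q \<longleftrightarrow>
      adder_gate q (tree_eval B adder_gate k (c False q)) (tree_eval B adder_gate k (c True q))" for k q
    by (simp add: c_def)
  have len: "\<bar>c b p\<bar>\<^sub>b = 3 * i + 2" "\<bar>c b' (c b p)\<bar>\<^sub>b = 3 * i + 3" "\<bar>c b'' (c b' (c b p))\<bar>\<^sub>b = Suc (3 * Suc i)" for b b' b''
    using Suc.prems(2) by (simp_all add: c_len c_nz p)
  have child: "T (c b (c b' (c b'' p))) \<longleftrightarrow>
     (if b'' \<and> \<not> b' then carry r x y else if (if b'' then b else b') then bit y r else bit x r)" for b b' b''
  proof -
    define q where "q = c b (c b' (c b'' p))"
    have bits: "bit q (k + 3) = bit p k" "bit q 2 \<longleftrightarrow> b''" "bit q 1 \<longleftrightarrow> b'" "bit q 0 \<longleftrightarrow> b" for k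
      unfolding q_def by (simp_all add: c_bit numeral_3_eq_3 numeral_2_eq_2)
    have "\<bar>q\<bar>\<^sub>b = Suc (3 * Suc i)"
      unfolding q_def by (rule len)
    from Suc.IH[OF _ this] Suc.prems(1) have "T q \<longleftrightarrow>
      (let d = path_depth q (Suc i); u = path_node q (Suc i) in
       if at_carry q then carry r (M (Suc d) (2 * u)) (M (Suc d) (Suc (2 * u))) else bit (M d u) r)"
      unfolding T_def by simp
    moreover have "descends q 0 \<longleftrightarrow> \<not> b'' \<or> b'" "to_right q 0 \<longleftrightarrow> (if b'' then b else b')"
      "at_carry q \<longleftrightarrow> b'' \<and> \<not> b'"
      unfolding descends_def to_right_def at_carry_def using bits unfolding numeral_2_eq_2 by simp_all
    ultimately show ?thesis
      unfolding path_step[of q p, OF bits(1)] q_def[symmetric] d_def[symmetric] u_def[symmetric] x_def y_def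
      by (cases b''; cases b'; cases b; simp add: Let_def)
  qed
  have "tree_eval B adder_gate (3 * Suc r) p =
    adder_gate p
      (adder_gate (c False p)
        (adder_gate (c False (c False p)) (T (c False (c False (c False p)))) (T (c True (c False (c False p)))))
        (adder_gate (c True (c False p)) (T (c False (c True (c False p)))) (T (c True (c True (c False p))))))
      (adder_gate (c True p)
        (adder_gate (c False (c True p)) (T (c False (c False (c True p)))) (T (c True (c False (c True p)))))
        (adder_gate (c True (c True p)) (T (c False (c True (c True p)))) (T (c True (c True (c True p))))))"
  proof -
    have "3 * Suc r = Suc (Suc (Suc (3 * r)))" by simp
    then show ?thesis unfolding T_def by (simp only: unfold)
  qed
  also have "\<dots> \<longleftrightarrow> (if at_carry p then bit x r \<and> bit y r \<or> carry r x y \<and> (bit x r \<or> bit y r)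
      else (bit x r \<noteq> bit y r) \<noteq> carry r x y)"
  proof -
    have mod: "(3 * i + 2) mod 3 = 2" "(3 * i + 3) mod 3 = 0" "Suc (3 * i) mod 3 = 1" by presburger+
    have bits: "bit (c b q) 3 = bit q 2" "bit (c b q) 2 = bit q 1" "bit (c b q) 1 = bit q 0" for b q
      by (simp_all add: c_bit numeral_3_eq_3 numeral_2_eq_2)
    show ?thesis
      unfolding adder_gate_def len Suc.prems(2) mod at_carry_def bits child c_bit(1) by auto
  qed
  also have "\<dots> \<longleftrightarrow> (if at_carry p then carry (Suc r) x y else bit (M d u) (Suc r))"
    unfolding carry_Suc bit_Suc M x_def[symmetric] y_def[symmetric] bit_add ..
  finally show ?case unfolding Let_def x_def y_def d_def u_def .
qed

definition subtree_count :: "(nat \<Rightarrow> bool) \<Rightarrow> nat \<Rightarrow> nat \<Rightarrow> nat" where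
  "subtree_count P k u = (\<Sum>i<2 ^ k. of_bool (P (u * 2 ^ k + i)))"

lemma sum_lessThan_add: "(\<Sum>i<m + n. f i) = (\<Sum>i<m. f i) + (\<Sum>i<n. f (m + i))" for f :: "nat \<Rightarrow> nat"
  by (induction n) simp_all

lemma subtree_count_Suc:
  "subtree_count P (Suc k) u = subtree_count P k (2 * u) + subtree_count P k (Suc (2 * u))"
proof -
  have idx: "2 * u * 2 ^ k + i = u * 2 ^ Suc k + i" "Suc (2 * u) * 2 ^ k + i = u * 2 ^ Suc k + (2 ^ k + i)" for i
    by simp_all
  have "{..<(2::nat) ^ Suc k} = {..<2 ^ k + 2 ^ k}" by simp
  then show ?thesis
    unfolding subtree_count_def idx by (simp only: sum_lessThan_add)
qed

text \<open>The leaves of the summation tree have depth \<open>h\<close>. The value 0 below them agrees with the half of the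
value at a leaf, which is 0 or 1.\<close>

definition weighted_count :: "(nat \<Rightarrow> bool) \<Rightarrow> nat \<Rightarrow> nat \<Rightarrow> nat \<Rightarrow> nat" where
  "weighted_count P h d u = (if d \<le> h then 2 ^ (h - d) * subtree_count P (h - d) u else 0)"

lemma weighted_count_div_2:
  "weighted_count P h d u div 2 = weighted_count P h (Suc d) (2 * u) + weighted_count P h (Suc d) (Suc (2 * u))"
proof (cases "d < h")
  case True
  then obtain k where k: "h - d = Suc k" "h - Suc d = k" by (metis Suc_diff_Suc)
  show ?thesis using True by (simp add: weighted_count_def k subtree_count_Suc distrib_left)
next
  case False
  then show ?thesis by (simp add: weighted_count_def subtree_count_def)
qed

lemma odd_weighted_count: "odd (weighted_count P h d u) \<longleftrightarrow> d = h \<and> P u"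
  by (cases "d < h") (auto simp: weighted_count_def subtree_count_def)

text \<open>Bit \<open>h + j\<close> of the scaled total at the root is bit \<open>j\<close> of the total. When no moves are left, an odd
scaled count occurs only at depth \<open>h\<close>, and there it is the truth value of \<open>P\<close>.\<close>

lemma tree_eval_count:
  assumes "\<And>p. \<bar>p\<bar>\<^sub>b = Suc (3 * (h + j)) \<Longrightarrow>
    B p \<longleftrightarrow> \<not> at_carry p \<and> path_depth p (h + j) = h \<and> P (path_node p (h + j))"
  shows "tree_eval B adder_gate (3 * (h + j)) 1 \<longleftrightarrow> bit (card {i. i < 2 ^ h \<and> P i}) j"
proof -
  have "tree_eval B adder_gate (3 * (h + j)) 1 \<longleftrightarrow> bit (weighted_count P h 0 0) (h + j)"
    by (subst tree_eval_adder[where M = "weighted_count P h" and m = "h + j" and i = 0])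
      (simp_all add: assms weighted_count_div_2 odd_weighted_count Let_def at_carry_def path_depth_def path_node_def bit_1_iff)
  also have "weighted_count P h 0 0 = 2 ^ h * card {i. i < 2 ^ h \<and> P i}"
  proof -
    have "{..<2 ^ h} \<inter> {i. P i} = {i. i < 2 ^ h \<and> P i}" by auto
    then show ?thesis by (simp add: weighted_count_def subtree_count_def sum.If_cases of_bool_def)
  qed
  also have "bit (2 ^ h * card {i. i < 2 ^ h \<and> P i}) (h + j) \<longleftrightarrow> bit (card {i. i < 2 ^ h \<and> P i}) j"
    by (simp add: bit_iff_odd power_add div_mult2_eq)
  finally show ?thesis .
qed

section \<open>Counting\<close>

lemma path_depth_eq_card: "path_depth p i = card {k. k < i \<and> descends p k}"
proof -
  have "{..<i} \<inter> {k. descends p k} = {k. k < i \<and> descends p k}" by auto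
  then show ?thesis by (simp add: path_depth_def of_bool_def sum.If_cases)
qed

lemma path_node_less: "path_node p i < 2 ^ path_depth p i"
proof (induction i)
  case (Suc i)
  have "path_node p (Suc i) = path_node p i + of_bool (descends p i \<and> to_right p i) * 2 ^ path_depth p i"
    "path_depth p (Suc i) = path_depth p i + of_bool (descends p i)"
    by (simp_all add: path_node_def path_depth_def)
  then show ?case using Suc by (cases "descends p i"; cases "to_right p i") simp_all
qed (simp add: path_node_def path_depth_def)

lemma bit_add_high:
  fixes m :: nat
  assumes "m < 2 ^ n"
  shows "bit (m + of_bool b * 2 ^ n) r \<longleftrightarrow> bit m r \<or> b \<and> r = n"
proof (cases b)
  case True
  have "\<not> bit m n" using assms bit_imp_less_blen[of m n] unfolding less_blen_iff by linarith
  then have "\<not> (bit m k \<and> bit (2 ^ n :: nat) k)" for k by (auto simp: bit_exp_iff)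
  then have "m + 2 ^ n = or m (2 ^ n)" using disjunctive_add[of m "2 ^ n"] by blast
  then show ?thesis using True by (auto simp: bit_or_iff bit_exp_iff)
qed simp

lemma bit_path_node:
  "bit (path_node p i) r \<longleftrightarrow> (\<exists>k<i. descends p k \<and> to_right p k \<and> path_depth p k = r)"
proof (induction i)
  case (Suc i)
  have "path_node p (Suc i) = path_node p i + of_bool (descends p i \<and> to_right p i) * 2 ^ path_depth p i"
    by (simp add: path_node_def)
  then show ?case using bit_add_high[OF path_node_less[of p i]] Suc by (auto simp: less_Suc_eq)
qed (simp add: path_node_def)

text \<open>Bit \<open>r\<close> of the address is set if some right move is followed by exactly \<open>r\<close> descents.\<close>

lemma path_node_eq_iff:
  assumes "path_depth p m = h" and "u < 2 ^ h"
  shows "u = path_node p m \<longleftrightarrow>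
    (\<forall>r<h. bit u r \<longleftrightarrow> (\<exists>k<m. descends p k \<and> to_right p k \<and> path_depth p k = r))"
proof
  assume *: "\<forall>r<h. bit u r \<longleftrightarrow> (\<exists>k<m. descends p k \<and> to_right p k \<and> path_depth p k = r)"
  have len: "\<bar>u\<bar>\<^sub>b \<le> h" "\<bar>path_node p m\<bar>\<^sub>b \<le> h"
    using path_node_less[of p m] assms by (simp_all add: blen_le_iff)
  show "u = path_node p m"
  proof (rule bit_eqI)
    fix r
    show "bit u r \<longleftrightarrow> bit (path_node p m) r"
    proof (cases "r < h")
      case True
      then show ?thesis using * bit_path_node[of p m r] by simp
    next
      case False
      then show ?thesis
        using len bit_imp_less_blen[of u r] bit_imp_less_blen[of "path_node p m" r] by linarith
    qed
  qed
qed (simp add: bit_path_node)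

lemma ba_definable_blen_mod_3:
  assumes "term_fun n t" and "c < 3"
  shows "ba_definable n (\<lambda>e. \<bar>t e\<bar>\<^sub>b mod 3 = c)"
proof -
  have "ba_definable n (\<lambda>e. \<exists>q \<le> \<bar>t e\<bar>\<^sub>b. \<bar>t e\<bar>\<^sub>b = 3 * q + c)"
    by (intro ba_definable_bex ba_definable_eq term_fun_plus term_fun_mult_const term_fun_blen
        term_fun_weaken[OF assms(1)] assms(1) term_fun_var term_fun_const) simp_all
  moreover have "(\<exists>q \<le> \<bar>t e\<bar>\<^sub>b. \<bar>t e\<bar>\<^sub>b = 3 * q + c) \<longleftrightarrow> \<bar>t e\<bar>\<^sub>b mod 3 = c" for e
  proof
    assume "\<bar>t e\<bar>\<^sub>b mod 3 = c"
    then have "\<bar>t e\<bar>\<^sub>b = 3 * (\<bar>t e\<bar>\<^sub>b div 3) + c" by presburger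
    then show "\<exists>q \<le> \<bar>t e\<bar>\<^sub>b. \<bar>t e\<bar>\<^sub>b = 3 * q + c" by (meson div_le_dividend)
  qed (use assms(2) in auto)
  ultimately show ?thesis by simp
qed

lemma ba_definable_adder_gate: "ba_definable (Suc n) (\<lambda>e. adder_gate (e 0) a b)"
  unfolding adder_gate_def
  by (intro ba_definable_if ba_definable_conj ba_definable_not ba_definable_const ba_definable_bit
      ba_definable_blen_mod_3 term_fun_var term_fun_const) simp_all

lemma ba_definable_descends:
  "term_fun n p \<Longrightarrow> term_fun n k \<Longrightarrow> ba_definable n (\<lambda>e. descends (p e) (k e))"
  unfolding descends_def
  by (intro ba_definable_disj ba_definable_not ba_definable_bit term_fun_plus term_fun_mult_const term_fun_const)

lemma ba_definable_to_right:
  "term_fun n p \<Longrightarrow> term_fun n k \<Longrightarrow> ba_definable n (\<lambda>e. to_right (p e) (k e))"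
  unfolding to_right_def
  by (intro ba_definable_if ba_definable_bit term_fun_plus term_fun_mult_const term_fun_const)

lemma ba_definable_path_depth:
  assumes "term_fun n p" and "logarithmic n k" and "term_fun n v"
  shows "ba_definable n (\<lambda>e. path_depth (p e) (k e) = v e)"
  unfolding path_depth_eq_card
  by (rule ba_definable_card) (intro ba_definable_descends term_fun_weaken[OF assms(1)] term_fun_var assms; simp)+

text \<open>At a leaf of the adder tree, the address \<open>u\<close> is guessed by a sharply bounded quantifier and compared
with the path, where depths are obtained by counting on a range of logarithmic length.\<close>

lemma tree_definable_count:
  assumes Q: "tree_definable (Suc n) (\<lambda>e. Q (e 0) (\<lambda>i. e (Suc i)))"
  shows "tree_definable (Suc (Suc n)) (\<lambda>e. bit (card {i. i < \<bar>e 1\<bar>\<^sub>b \<and> Q i (\<lambda>i. e (Suc (Suc i)))}) (e 0))"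
proof -
  define h where "h e = \<bar>\<bar>e 1\<bar>\<^sub>b\<bar>\<^sub>b" for e :: "nat \<Rightarrow> nat"
  (* Only positions below h can be set in a number below 2^h; the minimum keeps the depth
     logarithmic for all other values of e 0. *)
  define m where "m e = h e + min (e 0) (h e)" for e :: "nat \<Rightarrow> nat"
  define P where "P e i \<longleftrightarrow> i < \<bar>e 1\<bar>\<^sub>b \<and> Q i (\<lambda>i. e (Suc (Suc i)))" for e i
  (* The minimum with m e makes the range logarithmic for every k, as definability requires. *)
  define leaf where "leaf e p \<longleftrightarrow> (\<not> at_carry p \<and> path_depth p (m e) = h e) \<and>
    (\<exists>u \<le> \<bar>e 1\<bar>\<^sub>b. (u < \<bar>e 1\<bar>\<^sub>b \<and>
      (\<forall>r < h e. bit u r \<longleftrightarrow> (\<exists>k < m e. descends p k \<and> to_right p k \<and> path_depth p (min k (m e)) = r))) \<and>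
      Q u (\<lambda>i. e (Suc (Suc i))))" for e p
  have h: "logarithmic (Suc (Suc n)) h"
    unfolding h_def by (intro logarithmic_blen_blen term_fun_var) simp
  have m: "logarithmic (Suc (Suc n)) m"
    unfolding m_def by (intro logarithmic_plus logarithmic_min h term_fun_var) simp
  note hm = logarithmic_rename[OF h] logarithmic_rename[OF m]
    term_fun_rename[OF logarithmic_term_fun[OF h]] term_fun_rename[OF logarithmic_term_fun[OF m]]
  have at_carry: "ba_definable k (\<lambda>e. at_carry (p e))" if "term_fun k p" for k p
    unfolding at_carry_def by (intro ba_definable_conj ba_definable_not ba_definable_bit that term_fun_const)
  have top: "ba_definable (Suc (Suc (Suc n))) (\<lambda>e. \<not> at_carry (e 0) \<and> path_depth (e 0) (m (\<lambda>i. e (Suc i))) = h (\<lambda>i. e (Suc i)))"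
    by (intro ba_definable_conj ba_definable_not at_carry ba_definable_path_depth hm term_fun_var) simp_all
  have address: "ba_definable (Suc (Suc (Suc (Suc n)))) (\<lambda>e. e 0 < \<bar>e 3\<bar>\<^sub>b \<and>
      (\<forall>r < h (\<lambda>i. e (Suc (Suc i))). bit (e 0) r \<longleftrightarrow>
        (\<exists>k < m (\<lambda>i. e (Suc (Suc i))). descends (e 1) k \<and> to_right (e 1) k \<and> path_depth (e 1) (min k (m (\<lambda>i. e (Suc (Suc i))))) = r)))"
    by (intro ba_definable_conj ba_definable_less ba_definable_iff ba_definable_bit ba_definable_ball_less
        ba_definable_bex_less ba_definable_descends ba_definable_to_right ba_definable_path_depth
        logarithmic_min hm term_fun_var term_fun_blen) simp_all
  have item: "tree_definable (Suc (Suc (Suc (Suc n)))) (\<lambda>e. Q (e 0) (\<lambda>i. e (Suc (Suc (Suc (Suc i))))))"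
  proof -
    have "term_fun (Suc (Suc (Suc (Suc n)))) (\<lambda>e. case_nat (e 0) (\<lambda>i. e (Suc (Suc (Suc (Suc i))))) i)" if "i < Suc n" for i
      using that by (cases i) (simp_all add: term_fun_var)
    from tree_definable_subst[where f = "\<lambda>e. case_nat (e 0) (\<lambda>i. e (Suc (Suc (Suc (Suc i)))))", OF Q this]
    show ?thesis by simp
  qed
  have leaf: "tree_definable (Suc (Suc (Suc n))) (\<lambda>e. leaf (\<lambda>i. e (Suc i)) (e 0))"
    unfolding leaf_def
    by (rule tree_definable_conj, rule tree_definable_ba[OF top], rule tree_definable_bex, rule tree_definable_conj)
      (use tree_definable_ba[OF address] item in \<open>simp_all add: numeral_3_eq_3 term_fun_var\<close>)
  have main: "tree_definable (Suc (Suc n)) (\<lambda>e. tree_eval (leaf e) adder_gate (3 * m e) 1)"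
    by (rule tree_definable_graft[OF logarithmic_mult_const[OF m] ba_definable_adder_gate leaf])
  have "ba_definable (Suc (Suc n)) (\<lambda>e. e 0 \<le> h e)"
    by (intro ba_definable_le term_fun_var logarithmic_term_fun[OF h]) simp
  from tree_definable_if[OF this main tree_definable_ba[OF ba_definable_const]]
  have "tree_definable (Suc (Suc n)) (\<lambda>e. if e 0 \<le> h e then tree_eval (leaf e) adder_gate (3 * m e) 1 else False)" .
  moreover have "(if e 0 \<le> h e then tree_eval (leaf e) adder_gate (3 * m e) 1 else False) \<longleftrightarrow>
      bit (card {i. i < \<bar>e 1\<bar>\<^sub>b \<and> Q i (\<lambda>i. e (Suc (Suc i)))}) (e 0)" for e
  proof (cases "e 0 \<le> h e")
    case True
    then have m_eq: "m e = h e + e 0" by (simp add: m_def)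
    have small: "u < 2 ^ h e" if "u < \<bar>e 1\<bar>\<^sub>b" for u
      using that less_two_power_blen[of "\<bar>e 1\<bar>\<^sub>b"] unfolding h_def by linarith
    have "leaf e p \<longleftrightarrow> \<not> at_carry p \<and> path_depth p (m e) = h e \<and> P e (path_node p (m e))" for p
    proof (cases "path_depth p (m e) = h e")
      case True
      define address where "address u \<longleftrightarrow>
        (\<forall>r < h e. bit u r \<longleftrightarrow> (\<exists>k < m e. descends p k \<and> to_right p k \<and> path_depth p (min k (m e)) = r))" for u :: nat
      have node: "address u \<longleftrightarrow> u = path_node p (m e)" if "u < \<bar>e 1\<bar>\<^sub>b" for u
        unfolding path_node_eq_iff[OF True small[OF that]] address_def by (simp cong: conj_cong)
      have "leaf e p \<longleftrightarrow> \<not> at_carry p \<and> (\<exists>u \<le> \<bar>e 1\<bar>\<^sub>b. (u < \<bar>e 1\<bar>\<^sub>b \<and> address u) \<and> Q u (\<lambda>i. e (Suc (Suc i))))"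
        unfolding leaf_def address_def using True by simp
      also have "(\<exists>u \<le> \<bar>e 1\<bar>\<^sub>b. (u < \<bar>e 1\<bar>\<^sub>b \<and> address u) \<and> Q u (\<lambda>i. e (Suc (Suc i)))) \<longleftrightarrow> P e (path_node p (m e))"
      proof
        assume "\<exists>u \<le> \<bar>e 1\<bar>\<^sub>b. (u < \<bar>e 1\<bar>\<^sub>b \<and> address u) \<and> Q u (\<lambda>i. e (Suc (Suc i)))"
        then obtain u where u: "u < \<bar>e 1\<bar>\<^sub>b" "address u" "Q u (\<lambda>i. e (Suc (Suc i)))" by blast
        then show "P e (path_node p (m e))" using node[OF u(1)] by (simp add: P_def)
      next
        assume "P e (path_node p (m e))"
        then show "\<exists>u \<le> \<bar>e 1\<bar>\<^sub>b. (u < \<bar>e 1\<bar>\<^sub>b \<and> address u) \<and> Q u (\<lambda>i. e (Suc (Suc i)))"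
          using node[of "path_node p (m e)"] by (intro exI[of _ "path_node p (m e)"]) (simp add: P_def)
      qed
      finally show ?thesis using True by simp
    qed (simp add: leaf_def)
    then have "tree_eval (leaf e) adder_gate (3 * m e) 1 \<longleftrightarrow> bit (card {i. i < 2 ^ h e \<and> P e i}) (e 0)"
      unfolding m_eq by (intro tree_eval_count)
    also have "{i. i < 2 ^ h e \<and> P e i} = {i. i < \<bar>e 1\<bar>\<^sub>b \<and> Q i (\<lambda>i. e (Suc (Suc i)))}"
      using small by (auto simp: P_def)
    finally show ?thesis using True by simp
  next
    case False
    define c where "c = card {i. i < \<bar>e 1\<bar>\<^sub>b \<and> Q i (\<lambda>i. e (Suc (Suc i)))}"
    have "c \<le> \<bar>e 1\<bar>\<^sub>b" unfolding c_def using card_mono[of "{..<\<bar>e 1\<bar>\<^sub>b}" "{i. i < \<bar>e 1\<bar>\<^sub>b \<and> Q i (\<lambda>i. e (Suc (Suc i)))}"] by auto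
    then have "\<bar>c\<bar>\<^sub>b \<le> h e" unfolding h_def by (rule blen_mono)
    then have "\<not> bit c (e 0)" using False bit_imp_less_blen[of c "e 0"] by linarith
    then show ?thesis using False by (simp add: c_def)
  qed
  ultimately show ?thesis by simp
qed

theorem corollary2p1:
  fixes \<phi> :: aid_fm and n :: nat
  assumes "aid_formula (Suc n) \<phi>" and "Sigma0b \<phi>"
  shows "bitdefinable (Suc n) (\<lambda>xs. count_fun \<phi> (hd xs) (tl xs)) \<and>
    (\<forall>x ys. length ys = n \<longrightarrow> count_fun \<phi> x ys \<le> \<bar>x\<bar>\<^sub>b)"
proof -
  have le: "count_fun \<phi> x ys \<le> \<bar>x\<bar>\<^sub>b" for x ys
    unfolding count_fun_def using card_mono[of "{..<\<bar>x\<bar>\<^sub>b}" "{i. i < \<bar>x\<bar>\<^sub>b \<and> aid_sat ((!) (i # ys)) \<phi>}"] by auto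
  have "poly_growth (Suc n) (\<lambda>xs. count_fun \<phi> (hd xs) (tl xs))"
    unfolding poly_growth_def
  proof (intro exI[of _ "[:0, 1:]"] allI impI)
    fix xs :: "nat list" assume "length xs = Suc n"
    then obtain x ys where xs: "xs = x # ys" by (cases xs) simp_all
    have "\<bar>count_fun \<phi> x ys\<bar>\<^sub>b \<le> \<bar>x\<bar>\<^sub>b"
      using blen_le_self[of "count_fun \<phi> x ys"] le[of x ys] by linarith
    then show "\<bar>count_fun \<phi> (hd xs) (tl xs)\<bar>\<^sub>b \<le> poly [:0, 1:] (\<Sum>x\<leftarrow>xs. \<bar>x\<bar>\<^sub>b)"
      by (simp add: xs)
  qed
  moreover
  have "tree_definable (Suc n) (\<lambda>e. aid_sat (case_nat (e 0) (\<lambda>i. e (Suc i))) \<phi>)"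
    unfolding case_nat_0_Suc by (rule aid_formula_tree_definable[OF assms])
  from tree_definable_imp_ind[OF tree_definable_count[where Q = "\<lambda>i e. aid_sat (case_nat i e) \<phi>", OF this]]
  obtain S where S: "ind_sym_ok S" "ind_arity S = Suc (Suc n)"
    and iff: "\<And>xs. length xs = Suc (Suc n) \<Longrightarrow>
      bit (card {i. i < \<bar>xs ! 1\<bar>\<^sub>b \<and> aid_sat (case_nat i (\<lambda>i. xs ! Suc (Suc i))) \<phi>}) (xs ! 0) \<longleftrightarrow> ind_holds S xs 1"
    by blast
  define A where "A = Atom (Ind S (map Var [0..<Suc (Suc n)]) One)"
  have "aid_formula (Suc (Suc n)) A" "Sigma0b A" using S by (auto simp: A_def)
  moreover have "aid_sat ((!) (i # xs)) A \<longleftrightarrow> Bit i (count_fun \<phi> (hd xs) (tl xs)) = 1" if len: "length xs = Suc n" for i xs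
  proof -
    obtain x ys where xs: "xs = x # ys" using len by (cases xs) simp_all
    have env: "case_nat k ((!) ys) = (!) (k # ys)" for k
      by (rule ext) (simp add: nth_Cons)
    have "map (tm_val ((!) (i # xs)) \<circ> Var) [0..<Suc (Suc n)] = map ((!) (i # xs)) [0..<length (i # xs)]"
      using len by (simp add: comp_def)
    also have "\<dots> = i # xs" by (rule map_nth)
    finally have "aid_sat ((!) (i # xs)) A \<longleftrightarrow> ind_holds S (i # xs) 1"
      by (simp only: A_def fm_sat.simps aid_atom_sat.simps map_map tm_val.simps)
    also have "\<dots> \<longleftrightarrow> bit (card {k. k < \<bar>x\<bar>\<^sub>b \<and> aid_sat (case_nat k ((!) ys)) \<phi>}) i"
      using iff[of "i # xs"] len by (simp add: xs)
    also have "\<dots> \<longleftrightarrow> bit (count_fun \<phi> x ys) i"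
      unfolding count_fun_def env ..
    finally show ?thesis by (simp add: Bit_eq xs)
  qed
  ultimately have "bitdefinable (Suc n) (\<lambda>xs. count_fun \<phi> (hd xs) (tl xs))"
    unfolding bitdefinable_def by (intro conjI exI[of _ A]) simp_all
  then show ?thesis using le by simp
qed

end
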